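(* Let $(\mathcal{R},\mu)$ be resonant, let $\|\cdot\|_X$ be an r.i. quasi-Banach function norm on $\mathcal{M}(\mathcal{R},\mu)$ for which the Hardy–Littlewood–Pólya principle holds, and let $X$ be the corresponding r.i. quasi-Banach function space. If $f,g\in X$ satisfy $f\prec g$ and $g\in X_a$, then $f\in X_a$.
   Context: Let $(\mathcal{R},\mu)$ be a $\sigma$-finite measure space; $\mathcal{M}$ denotes the $\mu$-measurable extended complex-valued functions (identified a.e.), $\mathcal{M}_+$ the non-negative ones. $f_*(s)=\mu(\{|f|>s\})$, $f^*(t)=\inf\{s\ge0;\,f_*(s)\le t\}$ (non-increasing rearrangement). $(\mathcal{R},\mu)$ is called resonant if it is either non-atomic or completely atomic with all atoms of equal measure. A quasi-Banach function norm is a map $\|\cdot\|:\mathcal{M}\to[0,\infty]$ with $\|f\|=\||f|\|$ such that on $\mathcal{M}_+$: (Q1) $\|af\|=|a|\|f\|$, $\|f\|=0\iff f=0$ a.e., and there is $C\ge1$ (modulus of concavity) with $\|f+g\|\le C(\|f\|+\|g\|)$; (P2) $f\le g$ a.e. implies $\|f\|\le\|g\|$; (P3) $f_n\uparrow f$ a.e. implies $\|f_n\|\uparrow\|f\|$; (P4) $\|\chi_E\|<\infty$ whenever $\mu(E)<\infty$. The norm is rearrangement-invariant (r.i.) if $\|f\|=\|g\|$ whenever $f^*=g^*$. The corresponding space is $X=\{f\in\mathcal{M};\,\|f\|_X<\infty\}$. A function $f\in X$ has absolutely continuous quasinorm if $\|f\chi_{E_k}\|_X\to0$ for every sequence of measurable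 sets $E_k$ with $\chi_{E_k}\to0$ $\mu$-a.e.; $X_a$ denotes the set of such functions. Hardy–Littlewood–Pólya relation: $f\prec g$ means $\int_0^t f^*\,d\lambda\le\int_0^t g^*\,d\lambda$ for all $t\in(0,\infty)$. The Hardy–Littlewood–Pólya principle holds for $\|\cdot\|_X$ if $\|f\|_X\le\|g\|_X$ whenever $f\prec g$. *)

theory Defs
  imports "HOL-Analysis.Analysis"
begin

text \<open>Functions are represented by their absolute values, i.e. as non-negative
extended-real (ennreal) valued measurable functions; every notion in the
statement depends on a function only through its absolute value.\<close>

definition atom :: "'a measure \<Rightarrow> 'a set \<Rightarrow> bool" where
  "atom M A \<longleftrightarrow> A \<in> sets M \<and> emeasure M A > 0 \<and>
     (\<forall>B\<in>sets M. B \<subseteq> A \<longrightarrow> emeasure M B = 0 \<or> emeasure M (A - B) = 0)"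

definition non_atomic :: "'a measure \<Rightarrow> bool" where
  "non_atomic M \<longleftrightarrow> (\<nexists>A. atom M A)"

definition completely_atomic :: "'a measure \<Rightarrow> bool" where
  "completely_atomic M \<longleftrightarrow> (\<exists>\<A>. countable \<A> \<and> (\<forall>A\<in>\<A>. atom M A) \<and> disjoint \<A> \<and>
      space M - \<Union>\<A> \<in> sets M \<and> emeasure M (space M - \<Union>\<A>) = 0)"

definition resonant :: "'a measure \<Rightarrow> bool" where
  "resonant M \<longleftrightarrow> non_atomic M \<or>
     (completely_atomic M \<and> (\<forall>A B. atom M A \<longrightarrow> atom M B \<longrightarrow> emeasure M A = emeasure M B))"

definition distrib :: "'a measure \<Rightarrow> ('a \<Rightarrow> ennreal) \<Rightarrow> real \<Rightarrow> ennreal" where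
  "distrib M f s = emeasure M {x \<in> space M. ennreal s < f x}"

definition rearr :: "'a measure \<Rightarrow> ('a \<Rightarrow> ennreal) \<Rightarrow> real \<Rightarrow> ennreal" where
  "rearr M f t = Inf {ennreal s | s. s \<ge> 0 \<and> distrib M f s \<le> ennreal t}"

definition hlp_prec :: "'a measure \<Rightarrow> ('a \<Rightarrow> ennreal) \<Rightarrow> ('a \<Rightarrow> ennreal) \<Rightarrow> bool" where
  "hlp_prec M f g \<longleftrightarrow> (\<forall>t::real. t > 0 \<longrightarrow>
      (\<integral>\<^sup>+ s\<in>{0..t}. rearr M f s \<partial>lborel) \<le> (\<integral>\<^sup>+ s\<in>{0..t}. rearr M g s \<partial>lborel))"

definition quasi_banach_function_norm :: "'a measure \<Rightarrow> (('a \<Rightarrow> ennreal) \<Rightarrow> ennreal) \<Rightarrow> bool" where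
  "quasi_banach_function_norm M N \<longleftrightarrow>
     (\<forall>f\<in>borel_measurable M. \<forall>a::real. a \<ge> 0 \<longrightarrow> N (\<lambda>x. ennreal a * f x) = ennreal a * N f) \<and>
     (\<forall>f\<in>borel_measurable M. N f = 0 \<longleftrightarrow> (AE x in M. f x = 0)) \<and>
     (\<exists>C::real. C \<ge> 1 \<and> (\<forall>f\<in>borel_measurable M. \<forall>g\<in>borel_measurable M.
          N (\<lambda>x. f x + g x) \<le> ennreal C * (N f + N g))) \<and>
     (\<forall>f\<in>borel_measurable M. \<forall>g\<in>borel_measurable M. (AE x in M. f x \<le> g x) \<longrightarrow> N f \<le> N g) \<and>
     (\<forall>F f. (\<forall>n. F n \<in> borel_measurable M) \<longrightarrow> f \<in> borel_measurable M \<longrightarrow>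
          (AE x in M. incseq (\<lambda>n. F n x) \<and> (\<lambda>n. F n x) \<longlonglongrightarrow> f x) \<longrightarrow>
          incseq (\<lambda>n. N (F n)) \<and> (\<lambda>n. N (F n)) \<longlonglongrightarrow> N f) \<and>
     (\<forall>E\<in>sets M. emeasure M E < \<infinity> \<longrightarrow> N (indicator E) < \<infinity>)"

definition rearrangement_invariant :: "'a measure \<Rightarrow> (('a \<Rightarrow> ennreal) \<Rightarrow> ennreal) \<Rightarrow> bool" where
  "rearrangement_invariant M N \<longleftrightarrow>
     (\<forall>f\<in>borel_measurable M. \<forall>g\<in>borel_measurable M.
        (\<forall>t\<ge>0. rearr M f t = rearr M g t) \<longrightarrow> N f = N g)"

definition HLP_principle :: "'a measure \<Rightarrow> (('a \<Rightarrow> ennreal) \<Rightarrow> ennreal) \<Rightarrow> bool" where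
  "HLP_principle M N \<longleftrightarrow>
     (\<forall>f\<in>borel_measurable M. \<forall>g\<in>borel_measurable M. hlp_prec M f g \<longrightarrow> N f \<le> N g)"

definition fspace :: "'a measure \<Rightarrow> (('a \<Rightarrow> ennreal) \<Rightarrow> ennreal) \<Rightarrow> ('a \<Rightarrow> ennreal) set" where
  "fspace M N = {f \<in> borel_measurable M. N f < \<infinity>}"

definition abs_cont_part :: "'a measure \<Rightarrow> (('a \<Rightarrow> ennreal) \<Rightarrow> ennreal) \<Rightarrow> ('a \<Rightarrow> ennreal) set" where
  "abs_cont_part M N = {f \<in> fspace M N. \<forall>E::nat \<Rightarrow> 'a set. (\<forall>k. E k \<in> sets M) \<longrightarrow>
      (AE x in M. (\<lambda>k. indicator (E k) x :: real) \<longlonglongrightarrow> 0) \<longrightarrow>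
      (\<lambda>k. N (\<lambda>x. f x * indicator (E k) x)) \<longlonglongrightarrow> 0}"

end

theory Submission
  imports Defs
begin

text \<open>Writing \<open>excess f u\<close> for the integral of \<open>(f - u)\<^sup>+\<close>, Legendre duality turns \<open>f \<prec> g\<close> into
  \<open>excess f u \<le> excess g u\<close> for all \<open>u \<ge> 0\<close>, so that rearrangements disappear. For sets \<open>E\<^sub>k\<close> shrinking
  to a null set, split
  \<open>f \<chi>\<^bsub>E\<^sub>k\<^esub> \<le> (f - s)\<^sup>+ + s \<chi>\<^bsub>{f > \<epsilon>} \<inter> E\<^sub>k\<^esub> + min f \<epsilon>\<close>.
  First, \<open>(f - s)\<^sup>+ \<prec> (g - s)\<^sup>+\<close>, and the latter is small for large \<open>s\<close>, as \<open>g\<close> has absolutely continuous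
  quasinorm. Second, \<open>{f > \<epsilon>}\<close> has finite measure, and resonance together with \<open>g \<noteq> 0\<close> makes
  indicators of sets of small measure small in norm. Third, let sets \<open>D\<close> of finite measure exhaust the space.
  If \<open>\<parallel>\<chi>\<^sub>D\<parallel> / \<mu>(D)\<close> tends to \<open>0\<close>, then \<open>min f \<epsilon> \<prec> min g a + 2 \<epsilon> \<chi>\<^sub>D\<close> with \<open>\<epsilon> \<mu>(D) \<ge> excess g a\<close>
  shows that \<open>min f \<epsilon>\<close> is small. Otherwise averaging shows that \<open>f\<close> is integrable, and
  \<open>min f \<epsilon> \<prec> 2 \<epsilon> \<chi>\<^sub>D\<close> as soon as \<open>\<epsilon> \<mu>(D)\<close> is at least the integral of \<open>min f \<epsilon>\<close>.\<close>

section \<open>The excess of a function over a level\<close>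

text \<open>The level is finite, so the truncated subtraction is the positive part even where
  \<open>f\<close> is infinite. For \<open>u \<ge> 0\<close> and sigma-finite \<open>M\<close> this
  is the integral of the distribution function over the levels above \<open>u\<close>.\<close>

definition excess :: "'a measure \<Rightarrow> ('a \<Rightarrow> ennreal) \<Rightarrow> real \<Rightarrow> ennreal" where
  "excess M f u = (\<integral>\<^sup>+x. f x - ennreal u \<partial>M)"

section \<open>Layer-cake formula, rearrangements and Legendre duality\<close>

lemma ennreal_less_diff_iff:
  assumes "0 \<le> s" "0 \<le> u"
  shows "ennreal s < c - ennreal u \<longleftrightarrow> ennreal (u + s) < c"
  using assms by (cases c) (auto simp: ennreal_minus ennreal_less_iff simp del: ennreal_plus)

lemma emeasure_lborel_less:
  "emeasure lborel {s::real. 0 \<le> s \<and> ennreal s < c} = c"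
proof (cases c)
  case (real r)
  then have "{s::real. 0 \<le> s \<and> ennreal s < c} = {0..<r}"
    by (auto simp: ennreal_less_iff)
  then show ?thesis using real by simp
next
  case top
  have "{s::real. 0 \<le> s \<and> ennreal s < c} = {0..}"
    using top by auto
  moreover have "emeasure lborel {0::real..} = \<infinity>"
  proof -
    have "ennreal (real n) \<le> emeasure lborel {0::real..}" for n
      using emeasure_mono[of "{0..real n}" "{0..}" lborel] by simp
    then show ?thesis
      by (metis ennreal_Ex_less_of_nat ennreal_of_nat_eq_real_of_nat infinity_ennreal_def leD top.not_eq_extremum)
  qed
  ultimately show ?thesis using top by simp
qed

text \<open>Tonelli for the indicator of the region under the graph of \<open>h\<close>: its
  sections at \<open>x\<close> have length \<open>h x\<close>, those at height \<open>s\<close> are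
  the superlevel sets. It serves both for \<open>M\<close> and for Lebesgue measure.\<close>

lemma (in sigma_finite_measure) nn_integral_layer_cake:
  assumes [measurable]: "h \<in> borel_measurable M"
  shows "(\<integral>\<^sup>+x. h x \<partial>M) =
    (\<integral>\<^sup>+s. indicator {0..} s * emeasure M {x \<in> space M. ennreal s < h x} \<partial>lborel)"
proof -
  interpret pair_sigma_finite lborel M ..
  let ?F = "\<lambda>(s::real, x). indicator {(s, x). 0 \<le> s \<and> ennreal s < h x} (s, x) :: ennreal"
  have m: "?F \<in> borel_measurable (lborel \<Otimes>\<^sub>M M)"
    by measurable
  have "(\<integral>\<^sup>+x. h x \<partial>M) = (\<integral>\<^sup>+x. \<integral>\<^sup>+s. ?F (s, x) \<partial>lborel \<partial>M)"
  proof (intro nn_integral_cong)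
    fix x assume "x \<in> space M"
    have "(\<integral>\<^sup>+s. ?F (s, x) \<partial>lborel) = (\<integral>\<^sup>+s. indicator {s. 0 \<le> s \<and> ennreal s < h x} s \<partial>lborel)"
      by (intro nn_integral_cong) (auto simp: indicator_def)
    also have "\<dots> = h x"
      by (subst nn_integral_indicator) (auto simp: emeasure_lborel_less)
    finally show "h x = (\<integral>\<^sup>+s. ?F (s, x) \<partial>lborel)" by simp
  qed
  also have "\<dots> = (\<integral>\<^sup>+s. \<integral>\<^sup>+x. ?F (s, x) \<partial>M \<partial>lborel)"
    by (rule Fubini[OF m])
  also have "\<dots> = (\<integral>\<^sup>+s. indicator {0..} s * emeasure M {x \<in> space M. ennreal s < h x} \<partial>lborel)"
  proof (intro nn_integral_cong)
    fix s :: real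
    have "(\<integral>\<^sup>+x. ?F (s, x) \<partial>M) =
        (\<integral>\<^sup>+x. indicator {0..} s * indicator {x \<in> space M. ennreal s < h x} x \<partial>M)"
      by (intro nn_integral_cong) (auto simp: indicator_def)
    also have "\<dots> = indicator {0..} s * emeasure M {x \<in> space M. ennreal s < h x}"
      by (subst nn_integral_cmult) auto
    finally show "(\<integral>\<^sup>+x. ?F (s, x) \<partial>M) =
        indicator {0..} s * emeasure M {x \<in> space M. ennreal s < h x}" .
  qed
  finally show ?thesis .
qed

lemma distrib_antimono:
  assumes [measurable]: "f \<in> borel_measurable M" and "s \<le> s'"
  shows "distrib M f s' \<le> distrib M f s"
  unfolding distrib_def
  by (intro emeasure_mono) (use assms(2) in \<open>auto intro: le_less_trans[OF ennreal_leI]\<close>)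

text \<open>The direction from right to left is right continuity of the distribution function.\<close>

lemma less_rearr_iff:
  assumes [measurable]: "f \<in> borel_measurable M" and u: "0 \<le> u"
  shows "ennreal u < rearr M f t \<longleftrightarrow> ennreal t < distrib M f u"
proof
  assume "ennreal u < rearr M f t"
  moreover have "rearr M f t \<le> ennreal u" if "distrib M f u \<le> ennreal t"
    unfolding rearr_def by (rule Inf_lower) (use that u in auto)
  ultimately show "ennreal t < distrib M f u"
    by (meson leD not_le_imp_less)
next
  assume less: "ennreal t < distrib M f u"
  define A where "A n = {x \<in> space M. ennreal (u + 1 / Suc n) < f x}" for n
  have "incseq A"
  proof (intro incseq_SucI subsetI)
    fix n x assume x: "x \<in> A n"
    have "ennreal (u + 1 / Suc (Suc n)) \<le> ennreal (u + 1 / Suc n)"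
      by (intro ennreal_leI add_left_mono) (simp add: frac_le)
    then show "x \<in> A (Suc n)"
      using x unfolding A_def by (auto intro: le_less_trans)
  qed
  have U: "(\<Union>n. A n) = {x \<in> space M. ennreal u < f x}"
  proof safe
    fix x n assume "x \<in> A n"
    then have "x \<in> space M" and *: "ennreal (u + 1 / Suc n) < f x" by (auto simp: A_def)
    have "ennreal u \<le> ennreal (u + 1 / Suc n)"
      by (intro ennreal_leI) simp
    then show "x \<in> space M" "ennreal u < f x"
      using * \<open>x \<in> space M\<close> by (auto intro: le_less_trans)
  next
    fix x assume x: "x \<in> space M" "ennreal u < f x"
    then obtain r where r: "ennreal u < ennreal r" "ennreal r < f x" "0 \<le> r"
      by (metis dense ennreal_cases order_less_irrefl top.not_eq_extremum less_trans)
    then have "0 < r - u" using u by (simp add: ennreal_less_iff)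
    then obtain n where "1 / Suc n < r - u"
      using nat_approx_posE by metis
    then have "ennreal (u + 1 / Suc n) \<le> ennreal r"
      by (intro ennreal_leI) simp
    then have "x \<in> A n" using le_less_trans[OF _ r(2)] x unfolding A_def by blast
    then show "x \<in> (\<Union>n. A n)" by blast
  qed
  have "(SUP n. emeasure M (A n)) = emeasure M (\<Union>n. A n)"
    by (intro SUP_emeasure_incseq \<open>incseq A\<close>) (auto simp: A_def)
  then have "ennreal t < (SUP n. emeasure M (A n))"
    using less U by (simp add: distrib_def)
  then obtain n where n: "ennreal t < distrib M f (u + 1 / Suc n)"
    by (auto simp: less_SUP_iff A_def distrib_def)
  have "ennreal (u + 1 / Suc n) \<le> rearr M f t"
    unfolding rearr_def
  proof (rule Inf_greatest, safe)
    fix s :: real assume s: "0 \<le> s" "distrib M f s \<le> ennreal t"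
    have "\<not> s \<le> u + 1 / Suc n"
      using n s(2) distrib_antimono[of f M s "u + 1 / Suc n"] by auto
    then show "ennreal (u + 1 / Suc n) \<le> ennreal s"
      by (intro ennreal_leI) simp
  qed
  moreover have "ennreal u < ennreal (u + 1 / Suc n)"
    using u by (simp add: ennreal_less_iff del: ennreal_plus)
  ultimately show "ennreal u < rearr M f t" by (rule less_le_trans[rotated])
qed

lemma borel_measurable_rearr:
  assumes "f \<in> borel_measurable M"
  shows "rearr M f \<in> borel_measurable borel"
proof (rule borel_measurableI_greater)
  fix y :: ennreal
  show "{x \<in> space borel. y < rearr M f x} \<in> sets borel"
  proof (cases y)
    case (real r)
    then have "{x \<in> space borel. y < rearr M f x} = {t. ennreal t < distrib M f r}"
      using less_rearr_iff[OF assms] by auto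
    also have "\<dots> \<in> sets borel" by measurable
    finally show ?thesis .
  qed auto
qed

lemma antimono_rearr: "t \<le> t' \<Longrightarrow> rearr M f t' \<le> rearr M f t"
  unfolding rearr_def by (rule Inf_superset_mono) (blast intro: order_trans ennreal_leI)

text \<open>By \<open>less_rearr_iff\<close> the points \<open>t \<ge> 0\<close> where the
  rearrangement exceeds \<open>u + s\<close> form an interval of length
  \<open>distrib M f (u + s)\<close>. Hence both integrands are equimeasurable, and the layer-cake
  formula applies on each side.\<close>

lemma excess_rearr:
  assumes "sigma_finite_measure M" and [measurable]: "f \<in> borel_measurable M" and u: "0 \<le> u"
  shows "excess M f u = (\<integral>\<^sup>+t. (rearr M f t - ennreal u) * indicator {0..} t \<partial>lborel)"
proof -
  interpret sigma_finite_measure M by fact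
  note [measurable] = borel_measurable_rearr[OF assms(2)]
  have "emeasure M {x \<in> space M. ennreal s < f x - ennreal u} =
      emeasure lborel {t \<in> space lborel. ennreal s < (rearr M f t - ennreal u) * indicator {0..} t}"
    if s: "0 \<le> s" for s
  proof -
    have "{t \<in> space lborel. ennreal s < (rearr M f t - ennreal u) * indicator {0..} t}
        = {t. 0 \<le> t \<and> ennreal t < distrib M f (u + s)}"
      using s u by (auto simp: indicator_def ennreal_less_diff_iff less_rearr_iff simp del: ennreal_plus split: if_splits)
    then show ?thesis
      using s u by (simp only: emeasure_lborel_less ennreal_less_diff_iff distrib_def)
  qed
  then have "(\<integral>\<^sup>+s. indicator {0..} s * emeasure M {x \<in> space M. ennreal s < f x - ennreal u} \<partial>lborel)
      = (\<integral>\<^sup>+s. indicator {0..} s * emeasure lborel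
          {t \<in> space lborel. ennreal s < (rearr M f t - ennreal u) * indicator {0..} t} \<partial>lborel)"
    by (intro nn_integral_cong) (simp add: indicator_def)
  also have "\<dots> = (\<integral>\<^sup>+t. (rearr M f t - ennreal u) * indicator {0..} t \<partial>lborel)"
    by (rule sigma_finite_measure.nn_integral_layer_cake
        [OF lborel.sigma_finite_measure_axioms, symmetric]) measurable
  finally show ?thesis
    unfolding excess_def by (subst nn_integral_layer_cake) measurable
qed

text \<open>The integral of \<open>rearr M h\<close> over \<open>[0, t]\<close> is at most
  \<open>t * u + excess M h u\<close>, with equality at \<open>t = distrib M h u\<close> and at
  \<open>u = rearr M h t\<close> when these are finite. Each direction uses the optimal parameter
  for one function and the mere inequality for the other.\<close>

lemma hlp_prec_iff_excess:
  assumes "sigma_finite_measure M"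
    and [measurable]: "f \<in> borel_measurable M" "g \<in> borel_measurable M"
  shows "hlp_prec M f g \<longleftrightarrow> (\<forall>u\<ge>0. excess M f u \<le> excess M g u)"
proof
  note [measurable] = borel_measurable_rearr[OF assms(2)] borel_measurable_rearr[OF assms(3)]
  have le: "(\<integral>\<^sup>+s\<in>{0..t}. rearr M h s \<partial>lborel) \<le> ennreal (t * u) + excess M h u"
    if [measurable]: "h \<in> borel_measurable M" and "0 \<le> u" "0 < t" for h t u
  proof -
    note [measurable] = borel_measurable_rearr[OF that(1)]
    have "(\<integral>\<^sup>+s\<in>{0..t}. rearr M h s \<partial>lborel)
        \<le> (\<integral>\<^sup>+s. ennreal u * indicator {0..t} s + (rearr M h s - ennreal u) * indicator {0..} s \<partial>lborel)"
      by (intro nn_integral_mono) (auto simp: indicator_def add_diff_self_ennreal)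
    also have "\<dots> = ennreal (t * u) + excess M h u"
      using that by (subst nn_integral_add)
        (auto simp: nn_integral_cmult_indicator excess_rearr[OF assms(1)] ennreal_mult' mult.commute)
    finally show ?thesis .
  qed
  show "\<forall>u\<ge>0. excess M f u \<le> excess M g u" if prec: "hlp_prec M f g"
  proof (intro allI impI)
    fix u :: real assume u: "0 \<le> u"
    let ?d = "\<lambda>n t. (rearr M f t - ennreal u) * indicator {0..real n} t"
    have bound: "(\<integral>\<^sup>+t. ?d n t \<partial>lborel) \<le> excess M g u" for n
    proof -
      \<comment> \<open>\<open>T\<close> is the optimal endpoint: \<open>rearr M f\<close> exceeds
        \<open>u\<close> before \<open>distrib M f u\<close> and not after it. The cut at
        \<open>n\<close> keeps \<open>T\<close> finite, so that \<open>T * u\<close> can be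
        cancelled; monotone convergence in \<open>n\<close> removes the cut.\<close>
      define T where "T = enn2real (min (ennreal (real n)) (distrib M f u))"
      have T: "ennreal T = min (ennreal (real n)) (distrib M f u)" "0 \<le> T"
        unfolding T_def by (auto simp: min_less_iff_disj)
      \<comment> \<open>At the point \<open>T\<close> itself the rearrangement may lie below
        \<open>u\<close>, so that point is discarded.\<close>
      have AE: "AE t in lborel. ennreal u * indicator {0..T} t + ?d n t \<le> rearr M f t * indicator {0..T} t"
        using AE_lborel_singleton[of T]
      proof eventually_elim
        case (elim t)
        consider "t < 0" | "0 \<le> t" "t < T" | "T < t" using elim by linarith
        then show ?case
        proof cases
          case 2
          then have "ennreal t < ennreal T" by (simp add: ennreal_less_iff)
          then have "ennreal t < ennreal (real n)" "ennreal t < distrib M f u" by (auto simp: T(1))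
          then have "ennreal u < rearr M f t" "t < real n"
            using less_rearr_iff[of f M u t] u 2 by (auto simp: ennreal_less_iff)
          then show ?thesis
            using 2 by (simp add: add_diff_inverse_ennreal)
        next
          case 3
          show ?thesis
          proof (cases "t \<le> real n")
            case True
            then have "\<not> ennreal t < ennreal T" "\<not> ennreal (real n) \<le> ennreal T"
              using 3 T(2) by (auto simp: ennreal_less_iff)
            then have "\<not> ennreal t < distrib M f u"
              using T(1) by (auto simp: min_def split: if_splits)
            then have "rearr M f t \<le> ennreal u"
              using less_rearr_iff[of f M u t] u by simp
            then have "rearr M f t - ennreal u = 0"
              by (auto simp: diff_eq_0_iff_ennreal intro: le_less_trans)
            then show ?thesis using 3 by simp
          qed (use 3 in simp)
        qed auto
      qed
      have "ennreal (T * u) + (\<integral>\<^sup>+t. ?d n t \<partial>lborel)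
          = (\<integral>\<^sup>+t. ennreal u * indicator {0..T} t + ?d n t \<partial>lborel)"
        using T(2) u by (subst nn_integral_add)
          (auto simp: nn_integral_cmult_indicator ennreal_mult' mult.commute)
      also have "\<dots> \<le> (\<integral>\<^sup>+t\<in>{0..T}. rearr M f t \<partial>lborel)"
        by (rule nn_integral_mono_AE[OF AE])
      also have "\<dots> \<le> ennreal (T * u) + excess M g u"
      \<comment> \<open>The relation \<open>hlp_prec\<close> speaks only of positive
        endpoints.\<close>
      proof (cases "T = 0")
        case True
        have "(\<integral>\<^sup>+t\<in>{0..T}. rearr M f t \<partial>lborel) = (\<integral>\<^sup>+t. 0 \<partial>(lborel :: real measure))"
          using AE_lborel_singleton[of T] by (intro nn_integral_cong_AE) (auto simp: True indicator_def)
        then show ?thesis by simp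
      next
        case False
        then have "(\<integral>\<^sup>+t\<in>{0..T}. rearr M f t \<partial>lborel) \<le> (\<integral>\<^sup>+t\<in>{0..T}. rearr M g t \<partial>lborel)"
          using prec T(2) by (auto simp: hlp_prec_def)
        also have "\<dots> \<le> ennreal (T * u) + excess M g u"
          using False T(2) u by (intro le) auto
        finally show ?thesis .
      qed
      finally show ?thesis
        by (simp add: ennreal_add_left_cancel_le)
    qed
    have "excess M f u = (\<integral>\<^sup>+t. (SUP n. ?d n t) \<partial>lborel)"
    proof -
      have "(SUP n. ?d n t) = (rearr M f t - ennreal u) * indicator {0..} t" for t
      proof (rule antisym)
        show "(SUP n. ?d n t) \<le> (rearr M f t - ennreal u) * indicator {0..} t"
          by (rule SUP_least) (auto simp: indicator_def)
        obtain n where "t \<le> real n" using real_arch_simple by blast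
        then have "(rearr M f t - ennreal u) * indicator {0..} t = ?d n t"
          by (auto simp: indicator_def)
        also have "\<dots> \<le> (SUP n. ?d n t)" by (rule SUP_upper) simp
        finally show "(rearr M f t - ennreal u) * indicator {0..} t \<le> (SUP n. ?d n t)" .
      qed
      then show ?thesis using u by (simp add: excess_rearr[OF assms(1)])
    qed
    also have "\<dots> = (SUP n. \<integral>\<^sup>+t. ?d n t \<partial>lborel)"
      by (rule nn_integral_monotone_convergence_SUP)
        (auto simp: incseq_def le_fun_def indicator_def)
    also have "\<dots> \<le> excess M g u"
      using bound by (rule SUP_least)
    finally show "excess M f u \<le> excess M g u" .
  qed
  show "hlp_prec M f g" if ex: "\<forall>u\<ge>0. excess M f u \<le> excess M g u"
    unfolding hlp_prec_def
  proof (intro allI impI)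
    fix t :: real assume t: "0 < t"
    show "(\<integral>\<^sup>+s\<in>{0..t}. rearr M f s \<partial>lborel) \<le> (\<integral>\<^sup>+s\<in>{0..t}. rearr M g s \<partial>lborel)"
    proof (cases "rearr M g t")
      case top
      have "(\<integral>\<^sup>+s. rearr M g t * indicator {0..t} s \<partial>lborel) \<le> (\<integral>\<^sup>+s\<in>{0..t}. rearr M g s \<partial>lborel)"
        by (intro nn_integral_mono) (auto simp: indicator_def antimono_rearr)
      moreover have "(\<integral>\<^sup>+s. rearr M g t * indicator {0..t} s \<partial>lborel) = top"
        using top t by (subst nn_integral_cmult_indicator) (auto simp: ennreal_top_mult)
      ultimately show ?thesis by (simp add: top_unique)
    next
      \<comment> \<open>This \<open>u\<close> is the optimal level for \<open>g\<close>: the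
        rearrangement is at least \<open>u\<close> up to \<open>t\<close> and at most
        \<open>u\<close> afterwards, so the bound \<open>le\<close> is attained.\<close>
      case (real u)
      have "(\<integral>\<^sup>+s\<in>{0..t}. rearr M f s \<partial>lborel) \<le> ennreal (t * u) + excess M g u"
        using le[of f u t] ex real t by (auto intro: order_trans add_left_mono)
      also have "\<dots> = (\<integral>\<^sup>+s. ennreal u * indicator {0..t} s + (rearr M g s - ennreal u) * indicator {0..} s \<partial>lborel)"
        using real t by (subst nn_integral_add)
          (auto simp: nn_integral_cmult_indicator excess_rearr[OF assms(1)] ennreal_mult' mult.commute)
      also have "\<dots> \<le> (\<integral>\<^sup>+s\<in>{0..t}. rearr M g s \<partial>lborel)"
      proof (intro nn_integral_mono)
        fix s
        show "ennreal u * indicator {0..t} s + (rearr M g s - ennreal u) * indicator {0..} s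
          \<le> rearr M g s * indicator {0..t} s"
          using antimono_rearr[of s t M g] antimono_rearr[of t s M g] real
          by (auto simp: indicator_def add_diff_inverse_ennreal diff_eq_0_iff_ennreal not_le intro: le_less_trans)
      qed
      finally show ?thesis .
    qed
  qed
qed

section \<open>Elementary facts on extended non-negative reals and on the excess\<close>

lemma ennreal_tendsto_0_iff:
  "X \<longlonglongrightarrow> (0::ennreal) \<longleftrightarrow> (\<forall>e>0. eventually (\<lambda>k. X k < ennreal e) sequentially)"
proof safe
  fix e :: real assume "X \<longlonglongrightarrow> 0" "0 < e"
  then show "eventually (\<lambda>k. X k < ennreal e) sequentially"
    by (intro order_tendstoD(2)) auto
next
  assume *: "\<forall>e>0. eventually (\<lambda>k. X k < ennreal e) sequentially"
  show "X \<longlonglongrightarrow> 0"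
  proof (rule order_tendstoI)
    fix y :: ennreal assume "0 < y"
    then obtain z where z: "0 < z" "z < y" using dense by blast
    then obtain e where e: "z = ennreal e" "0 < e"
      by (cases z) auto
    then show "eventually (\<lambda>k. X k < y) sequentially"
      using *[rule_format, OF e(2)] z(2) by (auto elim!: eventually_mono)
  qed auto
qed

lemma ennreal_cmult_less_iff:
  assumes "0 < c"
  shows "ennreal c * x < ennreal (c * e) \<longleftrightarrow> x < ennreal e"
  using assms
  by (cases x; cases "0 \<le> e")
    (auto simp: ennreal_mult[symmetric] ennreal_less_iff ennreal_mult_top ennreal_neg mult_nonneg_nonpos)

text \<open>The Archimedean property; it later shows that norms and measures vanish when all their
  multiples stay below a finite bound.\<close>

lemma ennreal_multiples_bounded_imp_0:
  fixes x y :: ennreal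
  assumes "\<And>n::nat. ennreal (real n) * x \<le> y" "y < \<infinity>"
  shows "x = 0"
proof (rule ccontr)
  assume "x \<noteq> 0"
  show False
  proof (cases x)
    case top
    with assms(1)[of 1] assms(2) show ?thesis by (auto simp: top_unique)
  next
    case (real r)
    with \<open>x \<noteq> 0\<close> have r: "0 < r" by auto
    obtain b where b: "y = ennreal b" "0 \<le> b" using assms(2) by (cases y) auto
    obtain n :: nat where "b / r < real n" using reals_Archimedean2 by blast
    then have "b < real n * r" using r by (simp add: pos_divide_less_eq)
    moreover have "ennreal (real n * r) \<le> ennreal b"
      using assms(1)[of n] real b by (simp add: ennreal_mult)
    ultimately show ?thesis using b by (simp add: ennreal_le_iff)
  qed
qed

text \<open>Cutting off at \<open>s\<close> only shifts the level, so a comparison of all excesses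
  passes from two functions to their peaks above \<open>s\<close>.\<close>

lemma excess_diff:
  assumes "0 \<le> s" "0 \<le> u"
  shows "excess M (\<lambda>x. f x - ennreal s) u = excess M f (s + u)"
  using assms by (simp add: excess_def diff_add_eq_diff_diff_swap_ennreal)

lemma excess_mono: "(\<And>x. x \<in> space M \<Longrightarrow> f x \<le> g x) \<Longrightarrow> excess M f u \<le> excess M g u"
  unfolding excess_def by (intro nn_integral_mono ennreal_minus_mono) auto

lemma excess_antimono: "u \<le> v \<Longrightarrow> excess M f v \<le> excess M f u"
  unfolding excess_def by (intro nn_integral_mono ennreal_minus_mono ennreal_leI) auto

lemma excess_le_nn_integral: "excess M f u \<le> (\<integral>\<^sup>+x. f x \<partial>M)"
  unfolding excess_def by (intro nn_integral_mono) auto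

lemma excess_const_indicator:
  assumes [measurable]: "D \<in> sets M" and "0 \<le> u"
  shows "excess M (\<lambda>x. ennreal c * indicator D x) u = ennreal (c - u) * emeasure M D"
proof -
  have "excess M (\<lambda>x. ennreal c * indicator D x) u = (\<integral>\<^sup>+x. ennreal (c - u) * indicator D x \<partial>M)"
    unfolding excess_def using assms(2)
    by (intro nn_integral_cong) (auto simp: indicator_def ennreal_minus)
  then show ?thesis by (simp add: nn_integral_cmult_indicator)
qed

lemma excess_min_eq_0: "\<epsilon> \<le> u \<Longrightarrow> excess M (\<lambda>x. min (f x) (ennreal \<epsilon>)) u = 0"
proof -
  assume "\<epsilon> \<le> u"
  then have "min (f x) (ennreal \<epsilon>) - ennreal u = 0" for x
    by (auto simp: diff_eq_0_iff_ennreal min_le_iff_disj ennreal_leI min_less_iff_disj)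
  then show ?thesis by (simp add: excess_def)
qed

text \<open>Superadditivity, because truncated subtraction satisfies
  \<open>(a - u) + (b - u) \<le> (a + b) - u\<close>.\<close>

lemma excess_add_le:
  assumes [measurable]: "f \<in> borel_measurable M" "g \<in> borel_measurable M"
  shows "excess M f u + excess M g u \<le> excess M (\<lambda>x. f x + g x) u"
proof -
  have "(a - ennreal u) + (b - ennreal u) \<le> (a + b) - ennreal u" for a b
    by (cases a; cases b; cases "0 \<le> u")
      (auto simp: ennreal_minus_if ennreal_neg simp flip: ennreal_plus intro!: ennreal_leI)
  then show ?thesis
    unfolding excess_def by (subst nn_integral_add[symmetric]) (auto intro!: nn_integral_mono)
qed

section \<open>Sets of finite measure, atoms and halving\<close>

lemma (in sigma_finite_measure) exhaustion:
  obtains A :: "nat \<Rightarrow> 'a set"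
  where "range A \<subseteq> sets M" "incseq A" "(\<Union>n. A n) = space M" "\<And>n. emeasure M (A n) < \<infinity>"
  by (rule sigma_finite_incseq) (auto simp: less_top)

lemma (in sigma_finite_measure) positive_finite_subset:
  assumes [measurable]: "S \<in> sets M" and "emeasure M S \<noteq> 0"
  obtains B where "B \<in> sets M" "B \<subseteq> S" "0 < emeasure M B" "emeasure M B < \<infinity>"
proof -
  obtain A :: "nat \<Rightarrow> 'a set" where A: "range A \<subseteq> sets M" "incseq A" "(\<Union>n. A n) = space M" "\<And>n. emeasure M (A n) < \<infinity>"
    by (rule exhaustion) auto
  have [measurable]: "A n \<in> sets M" for n using A(1) by auto
  have "(SUP n. emeasure M (S \<inter> A n)) = emeasure M (\<Union>n. S \<inter> A n)"
    using A(2) by (intro SUP_emeasure_incseq) (auto simp: incseq_def)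
  also have "(\<Union>n. S \<inter> A n) = S" using A(3) sets.sets_into_space[OF assms(1)] by blast
  finally have "0 < (SUP n. emeasure M (S \<inter> A n))" using assms(2) by (simp add: zero_less_iff_neq_zero)
  then obtain n where "0 < emeasure M (S \<inter> A n)" by (auto simp: less_SUP_iff)
  moreover have "emeasure M (S \<inter> A n) \<le> emeasure M (A n)" by (intro emeasure_mono) auto
  ultimately show thesis
    using that[of "S \<inter> A n"] A(4)[of n] by (auto intro: le_less_trans)
qed

lemma exists_positive_level:
  assumes [measurable]: "g \<in> borel_measurable M" and "\<not> (AE x in M. g x = 0)"
  shows "\<exists>c>0. emeasure M {x \<in> space M. ennreal c < g x} \<noteq> 0"
proof (rule ccontr)
  assume *: "\<not> ?thesis"
  have "AE x in M. \<not> ennreal (1 / Suc n) < g x" for n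
  proof -
    have "emeasure M {x \<in> space M. ennreal (1 / Suc n) < g x} = 0"
      using * by auto
    then show ?thesis by (subst AE_iff_measurable[OF _ refl]) auto
  qed
  then have "AE x in M. \<forall>n. \<not> ennreal (1 / Suc n) < g x" by (simp add: AE_all_countable)
  then have "AE x in M. g x = 0"
  proof eventually_elim
    case (elim x)
    show ?case
    proof (rule ccontr)
      assume "g x \<noteq> 0"
      then obtain z where z: "0 < z" "z < g x" using dense[of 0 "g x"] by (auto simp: zero_less_iff_neq_zero)
      then obtain r where r: "z = ennreal r" "0 < r" by (cases z) auto
      obtain n where "1 / Suc n < r" using nat_approx_posE r(2) by metis
      then have "ennreal (1 / Suc n) \<le> ennreal r" by (intro ennreal_leI) simp
      then show False using elim z r by (meson le_less_trans)
    qed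
  qed
  with assms(2) show False ..
qed

text \<open>A non-null set meets one of the countably many atoms in a non-null set, and by atomicity
  that part carries the whole measure of the atom. The common measure of all atoms is the
  gap.\<close>

lemma equal_atoms_measure_gap:
  assumes "completely_atomic M" "\<And>A B. atom M A \<Longrightarrow> atom M B \<Longrightarrow> emeasure M A = emeasure M B"
  shows "\<exists>c>0. \<forall>D\<in>sets M. emeasure M D \<noteq> 0 \<longrightarrow> c \<le> emeasure M D"
proof -
  obtain \<A> where \<A>: "countable \<A>" "\<And>A. A \<in> \<A> \<Longrightarrow> atom M A"
    "space M - \<Union>\<A> \<in> sets M" "emeasure M (space M - \<Union>\<A>) = 0"
    using assms(1) unfolding completely_atomic_def by blast
  have *: "\<exists>A. atom M A \<and> emeasure M A \<le> emeasure M D" if D[measurable]: "D \<in> sets M" and "emeasure M D \<noteq> 0" for D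
  proof -
    have "\<exists>A\<in>\<A>. emeasure M (D \<inter> A) \<noteq> 0"
    proof (rule ccontr)
      assume neg: "\<not> ?thesis"
      have "(\<Union>A\<in>\<A>. D \<inter> A) \<in> null_sets M"
        using neg D \<A>(2) by (intro null_sets_UN'[OF \<A>(1)]) (auto simp: null_sets_def atom_def)
      moreover have "space M - \<Union>\<A> \<in> null_sets M" using \<A>(3,4) by blast
      moreover have "D \<subseteq> (\<Union>A\<in>\<A>. D \<inter> A) \<union> (space M - \<Union>\<A>)"
        using sets.sets_into_space[OF D] by blast
      ultimately have "D \<in> null_sets M" using D by (meson null_sets_subset null_sets.Un)
      then show False using that by auto
    qed
    then obtain A where A: "A \<in> \<A>" "emeasure M (D \<inter> A) \<noteq> 0" by blast
    then have at: "atom M A" and [measurable]: "A \<in> sets M" using \<A>(2) by (auto simp: atom_def)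
    then have "emeasure M (A - D \<inter> A) = 0"
      using A(2) D unfolding atom_def by (meson Int_lower2 sets.Int)
    then have "emeasure M A = emeasure M (D \<inter> A)"
      using plus_emeasure[of "D \<inter> A" M "A - D \<inter> A"] by (auto simp: Un_absorb1)
    also have "\<dots> \<le> emeasure M D" by (intro emeasure_mono) auto
    finally show ?thesis using at by blast
  qed
  show ?thesis
  proof (cases "\<exists>A. atom M A")
    case True
    then obtain A where "atom M A" by blast
    then have "0 < emeasure M A" by (simp add: atom_def)
    moreover have "emeasure M A \<le> emeasure M D" if "D \<in> sets M" "emeasure M D \<noteq> 0" for D
      using *[OF that] assms(2)[OF \<open>atom M A\<close>] by auto
    ultimately show ?thesis by blast
  next
    case False
    \<comment> \<open>Without atoms, \<open>*\<close> leaves only null sets, so any positive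
      constant serves.\<close>
    then show ?thesis using * by (intro exI[of _ 1]) auto
  qed
qed

text \<open>A set that is not an atom splits into two non-null pieces, and the smaller one has at
  most half of the measure.\<close>

lemma non_atomic_halving:
  assumes "non_atomic M" and [measurable]: "B \<in> sets M" and "0 < emeasure M B" "emeasure M B < \<infinity>"
  shows "\<exists>C. C \<in> sets M \<and> C \<subseteq> B \<and> 0 < emeasure M C \<and> 2 * emeasure M C \<le> emeasure M B"
proof -
  have "\<not> atom M B" using assms(1) by (auto simp: non_atomic_def)
  then obtain C where C[measurable]: "C \<in> sets M" and "C \<subseteq> B" "emeasure M C \<noteq> 0" "emeasure M (B - C) \<noteq> 0"
    using assms by (auto simp: atom_def)
  have "emeasure M B = emeasure M C + emeasure M (B - C)"
    using \<open>C \<subseteq> B\<close> by (subst plus_emeasure) (auto simp: Un_absorb1)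
  then consider "2 * emeasure M C \<le> emeasure M B" | "2 * emeasure M (B - C) \<le> emeasure M B"
    by (cases "emeasure M C \<le> emeasure M (B - C)") (auto simp: mult_2 add_mono)
  then show ?thesis
  proof cases
    case 1
    with C \<open>C \<subseteq> B\<close> \<open>emeasure M C \<noteq> 0\<close> show ?thesis by (intro exI[of _ C]) (auto simp: zero_less_iff_neq_zero)
  next
    case 2
    with \<open>emeasure M (B - C) \<noteq> 0\<close> show ?thesis by (intro exI[of _ "B - C"]) (auto simp: zero_less_iff_neq_zero)
  qed
qed

text \<open>Iterated halving leaves a null intersection, since \<open>2 ^ n\<close> times the
  measure of \<open>E n\<close> stays below that of \<open>B\<close>. Off the intersection,
  nestedness makes the indicators eventually zero.\<close>

lemma non_atomic_shrinking_sequence: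
  assumes "non_atomic M" and B: "B \<in> sets M" "0 < emeasure M B" "emeasure M B < \<infinity>"
  obtains E :: "nat \<Rightarrow> 'a set" where "\<And>n. E n \<in> sets M" "\<And>n. E n \<subseteq> B" "\<And>n. 0 < emeasure M (E n)"
    "AE x in M. (\<lambda>n. indicator (E n) x :: real) \<longlonglongrightarrow> 0"
proof -
  have "\<exists>E. \<forall>n. (E n \<in> sets M \<and> E n \<subseteq> B \<and> 0 < emeasure M (E n)) \<and> (E (Suc n) \<subseteq> E n \<and> 2 * emeasure M (E (Suc n)) \<le> emeasure M (E n))"
  proof (rule dependent_nat_choice)
    fix C :: "'a set" and n :: nat
    assume C: "C \<in> sets M \<and> C \<subseteq> B \<and> 0 < emeasure M C"
    then have "emeasure M C < \<infinity>" using B emeasure_mono[of C B M] by (auto intro: le_less_trans)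
    then show "\<exists>D. (D \<in> sets M \<and> D \<subseteq> B \<and> 0 < emeasure M D) \<and> D \<subseteq> C \<and> 2 * emeasure M D \<le> emeasure M C"
      using non_atomic_halving[OF assms(1), of C] C by blast
  qed (use B in auto)
  then obtain E where E: "\<And>n. E n \<in> sets M" "\<And>n. E n \<subseteq> B" "\<And>n. 0 < emeasure M (E n)"
    "\<And>n. E (Suc n) \<subseteq> E n" "\<And>n. 2 * emeasure M (E (Suc n)) \<le> emeasure M (E n)" by metis
  have dec: "decseq E" by (rule decseq_SucI) (rule E(4))
  have "ennreal (real n) * emeasure M (\<Inter>n. E n) \<le> emeasure M B" for n
  proof -
    have "ennreal (2 ^ n) * emeasure M (E n) \<le> emeasure M B"
    proof (induction n)
      case 0
      show ?case using E(2)[of 0] B by (auto intro: emeasure_mono)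
    next
      case (Suc n)
      have "ennreal (2 ^ Suc n) * emeasure M (E (Suc n)) = ennreal (2 ^ n) * (2 * emeasure M (E (Suc n)))"
        by (simp add: ennreal_mult mult_ac)
      also have "\<dots> \<le> ennreal (2 ^ n) * emeasure M (E n)" by (intro mult_left_mono E(5)) auto
      finally show ?case using Suc by simp
    qed
    moreover have "ennreal (real n) \<le> ennreal (2 ^ n)"
      by (intro ennreal_leI) (use of_nat_less_two_power[of n, where 'a = real] in simp)
    moreover have "emeasure M (\<Inter>n. E n) \<le> emeasure M (E n)" using E(1) by (intro emeasure_mono) auto
    ultimately show ?thesis by (meson mult_mono order_trans zero_le)
  qed
  then have "emeasure M (\<Inter>n. E n) = 0" using B(3) by (rule ennreal_multiples_bounded_imp_0)
  then have "(\<Inter>n. E n) \<in> null_sets M" using E(1) by auto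
  then have "AE x in M. x \<notin> (\<Inter>n. E n)" by (rule AE_not_in)
  then have "AE x in M. (\<lambda>n. indicator (E n) x :: real) \<longlonglongrightarrow> 0"
  proof eventually_elim
    case (elim x)
    then obtain n where "x \<notin> E n" by blast
    then have "\<forall>m\<ge>n. x \<notin> E m" using dec by (auto simp: decseq_def)
    then show ?case
      by (intro tendsto_eventually) (auto simp: eventually_sequentially intro!: exI[of _ n])
  qed
  then show thesis using that E(1-3) by blast
qed

section \<open>Norms satisfying the Hardy--Littlewood--Polya principle\<close>

locale hlp_function_norm = sigma_finite_measure M for M :: "'a measure" +
  fixes N :: "('a \<Rightarrow> ennreal) \<Rightarrow> ennreal"
  assumes quasi_norm: "quasi_banach_function_norm M N"
    and HLP: "HLP_principle M N"
begin

section \<open>Consequences of the axioms and of the principle\<close>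

lemma N_scale: "f \<in> borel_measurable M \<Longrightarrow> 0 \<le> a \<Longrightarrow> N (\<lambda>x. ennreal a * f x) = ennreal a * N f"
  using quasi_norm unfolding quasi_banach_function_norm_def by blast

lemma N_eq_0_iff: "f \<in> borel_measurable M \<Longrightarrow> N f = 0 \<longleftrightarrow> (AE x in M. f x = 0)"
  using quasi_norm unfolding quasi_banach_function_norm_def by blast

lemma N_mono_AE:
  "f \<in> borel_measurable M \<Longrightarrow> g \<in> borel_measurable M \<Longrightarrow> (AE x in M. f x \<le> g x) \<Longrightarrow> N f \<le> N g"
  using quasi_norm unfolding quasi_banach_function_norm_def by blast

lemma N_mono:
  "f \<in> borel_measurable M \<Longrightarrow> g \<in> borel_measurable M \<Longrightarrow> (\<And>x. x \<in> space M \<Longrightarrow> f x \<le> g x) \<Longrightarrow> N f \<le> N g"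
  by (rule N_mono_AE) auto

lemma N_indicator_finite: "E \<in> sets M \<Longrightarrow> emeasure M E < \<infinity> \<Longrightarrow> N (indicator E) < \<infinity>"
  using quasi_norm unfolding quasi_banach_function_norm_def by blast

lemma N_const_indicator:
  "E \<in> sets M \<Longrightarrow> 0 \<le> a \<Longrightarrow> N (\<lambda>x. ennreal a * indicator E x) = ennreal a * N (indicator E)"
  by (rule N_scale) auto

text \<open>The only form in which the principle is applied: norms are compared through excesses
  alone.\<close>

lemma N_le_if_excess_le:
  assumes "f \<in> borel_measurable M" "g \<in> borel_measurable M" "\<And>u. 0 \<le> u \<Longrightarrow> excess M f u \<le> excess M g u"
  shows "N f \<le> N g"
  using HLP assms hlp_prec_iff_excess[OF sigma_finite_measure_axioms, of f g]
  unfolding HLP_principle_def by blast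

text \<open>Continuity of addition at zero; it hides the modulus of concavity \<open>C\<close> in
  the choice \<open>d = e / (2 * C)\<close>.\<close>

lemma N_add_small:
  assumes "0 < e"
  obtains d where "0 < d"
    "\<And>p q. p \<in> borel_measurable M \<Longrightarrow> q \<in> borel_measurable M \<Longrightarrow> N p < ennreal d \<Longrightarrow> N q < ennreal d \<Longrightarrow>
      N (\<lambda>x. p x + q x) < ennreal e"
proof -
  have "\<exists>C::real. C \<ge> 1 \<and> (\<forall>f\<in>borel_measurable M. \<forall>g\<in>borel_measurable M.
      N (\<lambda>x. f x + g x) \<le> ennreal C * (N f + N g))"
    using quasi_norm unfolding quasi_banach_function_norm_def by (elim conjE)
  then obtain C where C: "1 \<le> C" "\<forall>f\<in>borel_measurable M. \<forall>g\<in>borel_measurable M.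
      N (\<lambda>x. f x + g x) \<le> ennreal C * (N f + N g)"
    by blast
  show thesis
  proof (rule that[of "e / (2 * C)"])
    show "0 < e / (2 * C)" using C assms by simp
    fix p q assume meas: "p \<in> borel_measurable M" "q \<in> borel_measurable M"
      and small: "N p < ennreal (e / (2 * C))" "N q < ennreal (e / (2 * C))"
    obtain a where a: "N p = ennreal a" "0 \<le> a" using small(1) by (cases "N p") auto
    obtain b where b: "N q = ennreal b" "0 \<le> b" using small(2) by (cases "N q") auto
    have "a < e / (2 * C)" "b < e / (2 * C)" using small a b by (auto simp: ennreal_less_iff)
    then have "a + b < e / C" by simp
    then have "C * (a + b) < e" using C(1) by (simp add: field_simps)
    moreover have "ennreal C * (N p + N q) = ennreal (C * (a + b))"
      using a b C(1) by (simp add: ennreal_mult)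
    ultimately show "N (\<lambda>x. p x + q x) < ennreal e"
      using le_less_trans[OF C(2)[rule_format, OF meas], of "ennreal e"] a b C(1) assms by (simp add: ennreal_less_iff)
  qed
qed

text \<open>The excess of an indicator at level \<open>u\<close> is the positive part of
  \<open>1 - u\<close> times the measure of the set, so no inclusion between the sets is
  involved.\<close>

lemma N_indicator_mono_measure:
  assumes [measurable]: "D \<in> sets M" "B \<in> sets M" and "emeasure M D \<le> emeasure M B"
  shows "N (indicator D) \<le> N (indicator B)"
proof (rule N_le_if_excess_le)
  fix u :: real assume "0 \<le> u"
  then show "excess M (indicator D) u \<le> excess M (indicator B) u"
    using excess_const_indicator[of D M u 1] excess_const_indicator[of B M u 1] assms
    by (auto intro: mult_left_mono)
qed auto

lemma N_indicator_neq_0: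
  assumes [measurable]: "B \<in> sets M" and "0 < emeasure M B"
  shows "N (indicator B) \<noteq> 0"
proof
  assume "N (indicator B) = 0"
  then have "AE x in M. indicator B x = (0::ennreal)" by (subst (asm) N_eq_0_iff) auto
  then have "AE x in M. x \<notin> B" by (auto simp: indicator_def split: if_splits)
  then have "emeasure M B = 0" by (subst (asm) AE_iff_measurable[of B]) (use sets.sets_into_space[OF assms(1)] in auto)
  then show False using assms by simp
qed

text \<open>All multiples of the indicator of \<open>{g = \<infinity>}\<close> lie below
  \<open>g\<close>, so its norm vanishes.\<close>

lemma AE_finite_if_N_finite:
  assumes [measurable]: "g \<in> borel_measurable M" and "N g < \<infinity>"
  shows "AE x in M. g x < \<infinity>"
proof -
  define E where "E = {x \<in> space M. g x = \<infinity>}"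
  have [measurable]: "E \<in> sets M" by (simp add: E_def)
  have "ennreal (real n) * N (indicator E) \<le> N g" for n
  proof -
    have "N (\<lambda>x. ennreal (real n) * indicator E x) \<le> N g"
      by (rule N_mono) (auto simp: indicator_def E_def)
    then show ?thesis by (simp add: N_const_indicator)
  qed
  then have "N (indicator E) = 0" using assms(2) by (rule ennreal_multiples_bounded_imp_0)
  then have "AE x in M. indicator E x = (0::ennreal)" by (subst (asm) N_eq_0_iff) auto
  then show ?thesis
    using AE_space by eventually_elim (auto simp: E_def indicator_def less_top split: if_splits)
qed

section \<open>Functions with absolutely continuous quasinorm\<close>

lemma abs_cont_partD:
  assumes "g \<in> abs_cont_part M N"
  shows "g \<in> borel_measurable M" "N g < \<infinity>"
    "\<And>E :: nat \<Rightarrow> 'a set. (\<And>k. E k \<in> sets M) \<Longrightarrow> (AE x in M. (\<lambda>k. indicator (E k) x :: real) \<longlonglongrightarrow> 0) \<Longrightarrow>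
      (\<lambda>k. N (\<lambda>x. g x * indicator (E k) x)) \<longlonglongrightarrow> 0"
  using assms unfolding abs_cont_part_def fspace_def by auto

lemma abs_cont_part_small:
  assumes "g \<in> abs_cont_part M N" "\<And>k. E k \<in> sets M"
    "AE x in M. (\<lambda>k. indicator (E k) x :: real) \<longlonglongrightarrow> 0" "0 < e"
  obtains k :: nat where "N (\<lambda>x. g x * indicator (E k) x) < ennreal e"
proof -
  have "eventually (\<lambda>k. N (\<lambda>x. g x * indicator (E k) x) < ennreal e) sequentially"
    using abs_cont_partD(3)[OF assms(1-3)] assms(4) unfolding ennreal_tendsto_0_iff by blast
  then show thesis using that by (auto simp: eventually_sequentially)
qed

text \<open>The peak above \<open>n\<close> is dominated by \<open>g\<close> restricted to
  \<open>{g > n}\<close>, and these sets shrink to the null set where \<open>g\<close> is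
  infinite.\<close>

lemma abs_cont_peak_small:
  assumes g: "g \<in> abs_cont_part M N" and "0 < e"
  obtains s where "0 \<le> s" "N (\<lambda>x. g x - ennreal s) < ennreal e"
proof -
  have [measurable]: "g \<in> borel_measurable M" by (rule abs_cont_partD(1)[OF g])
  let ?E = "\<lambda>n. {x \<in> space M. ennreal (real n) < g x}"
  have "AE x in M. (\<lambda>n. indicator (?E n) x :: real) \<longlonglongrightarrow> 0"
    using AE_finite_if_N_finite[OF abs_cont_partD(1,2)[OF g]]
  proof eventually_elim
    case (elim x)
    then obtain r where r: "g x = ennreal r" "0 \<le> r" by (cases "g x") auto
    obtain m where "r \<le> real m" using real_arch_simple by blast
    then have "\<forall>n\<ge>m. x \<notin> ?E n" using r by (auto simp: ennreal_less_iff)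
    then show ?case
      by (intro tendsto_eventually) (auto simp: eventually_sequentially indicator_def intro!: exI[of _ m])
  qed
  then obtain n where n: "N (\<lambda>x. g x * indicator (?E n) x) < ennreal e"
    using abs_cont_part_small[OF g, of ?E] assms(2) by (auto elim: meta_mp)
  have "N (\<lambda>x. g x - ennreal (real n)) \<le> N (\<lambda>x. g x * indicator (?E n) x)"
    by (rule N_mono) (auto simp: indicator_def diff_eq_0_iff_ennreal not_less intro: le_less_trans)
  then show thesis using n by (intro that[of "real n"]) auto
qed

lemma indicator_complement_exhaustion_tendsto:
  assumes "incseq A" "(\<Union>n. A n) = space M"
  shows "AE x in M. (\<lambda>n. indicator (space M - A n) x :: real) \<longlonglongrightarrow> 0"
proof (rule AE_I2)
  fix x assume "x \<in> space M"
  then obtain m where "x \<in> A m" using assms(2) by blast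
  then have "\<forall>n\<ge>m. x \<in> A n" using assms(1) by (auto simp: incseq_def)
  then show "(\<lambda>n. indicator (space M - A n) x :: real) \<longlonglongrightarrow> 0"
    by (intro tendsto_eventually) (auto simp: eventually_sequentially indicator_def intro!: exI[of _ m])
qed

text \<open>First \<open>A n\<close> is taken so large that \<open>g\<close> is small in norm
  outside it; then \<open>a\<close> is taken small relative to the norm of the indicator of
  \<open>A n\<close>.\<close>

lemma abs_cont_min_small:
  assumes g: "g \<in> abs_cont_part M N" and "0 < e"
  obtains a where "0 < a" "N (\<lambda>x. min (g x) (ennreal a)) < ennreal e"
proof -
  have [measurable]: "g \<in> borel_measurable M" by (rule abs_cont_partD(1)[OF g])
  obtain d where d: "0 < d" "\<And>p q. p \<in> borel_measurable M \<Longrightarrow> q \<in> borel_measurable M \<Longrightarrow>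
      N p < ennreal d \<Longrightarrow> N q < ennreal d \<Longrightarrow> N (\<lambda>x. p x + q x) < ennreal e"
    using N_add_small[OF assms(2)] by blast
  obtain A :: "nat \<Rightarrow> 'a set" where A: "range A \<subseteq> sets M" "incseq A" "(\<Union>n. A n) = space M"
    "\<And>n. emeasure M (A n) < \<infinity>"
    by (rule exhaustion) auto
  have [measurable]: "A n \<in> sets M" for n using A(1) by auto
  obtain n where n: "N (\<lambda>x. g x * indicator (space M - A n) x) < ennreal d"
    using abs_cont_part_small[OF g, of "\<lambda>n. space M - A n" d]
      indicator_complement_exhaustion_tendsto[OF A(2,3)] d(1) by auto
  obtain r where r: "N (indicator (A n)) = ennreal r" "0 \<le> r"
    using N_indicator_finite[of "A n"] A(4) by (cases "N (indicator (A n))") auto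
  \<comment> \<open>The norm \<open>r\<close> may be zero, hence \<open>r + 1\<close>.\<close>
  define a where "a = d / (r + 1)"
  have a: "0 < a" "a * r < d"
    using d(1) r(2) by (auto simp: a_def field_simps)
  have "N (\<lambda>x. ennreal a * indicator (A n) x) < ennreal d"
    using a d(1) r by (simp add: N_const_indicator ennreal_mult[symmetric] ennreal_less_iff)
  then have "N (\<lambda>x. g x * indicator (space M - A n) x + ennreal a * indicator (A n) x) < ennreal e"
    using n by (intro d(2)) auto
  moreover have "N (\<lambda>x. min (g x) (ennreal a))
      \<le> N (\<lambda>x. g x * indicator (space M - A n) x + ennreal a * indicator (A n) x)"
    by (rule N_mono) (auto simp: indicator_def)
  ultimately show thesis using a(1) by (intro that[of a]) auto
qed

text \<open>A level set \<open>S\<close> of infinite measure would keep infinite measure after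
  removal of any \<open>A n\<close>, so the indicator of \<open>S - A n\<close> would have at least
  the norm of that of a fixed non-null \<open>B\<close>. But \<open>a\<close> times it lies below
  the tail of \<open>g\<close> outside \<open>A n\<close>, whose norm tends to zero.\<close>

lemma abs_cont_level_finite:
  assumes g: "g \<in> abs_cont_part M N" and "0 < a"
  shows "emeasure M {x \<in> space M. ennreal a < g x} < \<infinity>"
proof (rule ccontr)
  have [measurable]: "g \<in> borel_measurable M" by (rule abs_cont_partD(1)[OF g])
  define S where "S = {x \<in> space M. ennreal a < g x}"
  have [measurable]: "S \<in> sets M" by (simp add: S_def)
  assume "\<not> emeasure M {x \<in> space M. ennreal a < g x} < \<infinity>"
  then have S: "emeasure M S = \<infinity>" by (simp add: S_def not_less top_unique)
  obtain A :: "nat \<Rightarrow> 'a set" where A: "range A \<subseteq> sets M" "incseq A" "(\<Union>n. A n) = space M"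
    "\<And>n. emeasure M (A n) < \<infinity>"
    by (rule exhaustion) auto
  have [measurable]: "A n \<in> sets M" for n using A(1) by auto
  obtain B where B[measurable]: "B \<in> sets M" and "0 < emeasure M B"
    using positive_finite_subset[of S] S by auto
  then have "N (indicator B) \<noteq> 0" by (intro N_indicator_neq_0)
  then obtain z where z: "0 < z" "z < N (indicator B)"
    using dense[of 0 "N (indicator B)"] by (auto simp: zero_less_iff_neq_zero)
  then obtain r where r: "z = ennreal r" "0 < r" by (cases z) auto
  obtain n where n: "N (\<lambda>x. g x * indicator (space M - A n) x) < ennreal (a * r)"
    using abs_cont_part_small[OF g, of "\<lambda>n. space M - A n" "a * r"]
      indicator_complement_exhaustion_tendsto[OF A(2,3)] r assms(2) by auto
  have "emeasure M S \<le> emeasure M (S - A n) + emeasure M (A n)"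
    by (rule order_trans[OF _ emeasure_subadditive]) (auto intro: emeasure_mono)
  then have "emeasure M (S - A n) = \<infinity>" using S A(4)[of n] by (auto simp: top_unique ennreal_add_eq_top)
  then have "N (indicator B) \<le> N (indicator (S - A n))" by (intro N_indicator_mono_measure) auto
  moreover have "N (\<lambda>x. ennreal a * indicator (S - A n) x) \<le> N (\<lambda>x. g x * indicator (space M - A n) x)"
    by (rule N_mono) (auto simp: indicator_def S_def)
  ultimately have "ennreal a * N (indicator B) < ennreal (a * r)"
    using n assms(2) by (simp add: N_const_indicator) (meson le_less_trans mult_left_mono zero_le)
  then show False using z r assms(2) by (auto simp: ennreal_cmult_less_iff)
qed

text \<open>An infinite excess at a level \<open>a\<close> above which \<open>g\<close> lives on a set of finite measure
  is infinite at all levels; then \<open>g\<close> would majorise every multiple of an indicator.\<close>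

lemma abs_cont_excess_finite:
  assumes g: "g \<in> abs_cont_part M N" and "0 < a"
  shows "excess M g a < \<infinity>"
proof (rule ccontr)
  have [measurable]: "g \<in> borel_measurable M" by (rule abs_cont_partD(1)[OF g])
  define S where "S = {x \<in> space M. ennreal a < g x}"
  have [measurable]: "S \<in> sets M" by (simp add: S_def)
  have S: "emeasure M S < \<infinity>" unfolding S_def by (rule abs_cont_level_finite[OF assms])
  assume "\<not> excess M g a < \<infinity>"
  then have inf: "excess M g a = \<infinity>" by (simp add: not_less top_unique)
  have all: "excess M g u = \<infinity>" if "0 \<le> u" for u
  proof (cases "u \<le> a")
    case True
    then show ?thesis using excess_antimono[OF True, of M g] inf by (simp add: top_unique)
  next
    case False
    \<comment> \<open>Raising the level from \<open>a\<close> to \<open>u\<close> costs at most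
      \<open>u - a\<close>, and only on \<open>S\<close>, which has finite measure.\<close>
    have "excess M g a \<le> (\<integral>\<^sup>+x. (g x - ennreal u) + ennreal (u - a) * indicator S x \<partial>M)"
      unfolding excess_def
    proof (intro nn_integral_mono)
      fix x assume "x \<in> space M"
      then show "g x - ennreal a \<le> (g x - ennreal u) + ennreal (u - a) * indicator S x"
        using assms(2) False
        by (cases "g x") (auto simp: S_def indicator_def ennreal_minus_if ennreal_less_iff simp flip: ennreal_plus)
    qed
    also have "\<dots> = excess M g u + ennreal (u - a) * emeasure M S"
      by (simp add: nn_integral_add nn_integral_cmult_indicator excess_def)
    finally have "excess M g u + ennreal (u - a) * emeasure M S = \<infinity>" using inf by (simp add: top_unique)
    moreover have "ennreal (u - a) * emeasure M S < \<infinity>" using S by (simp add: ennreal_mult_less_top)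
    ultimately show ?thesis by (auto simp: ennreal_add_eq_top)
  qed
  have "space M \<notin> null_sets M"
  proof
    assume "space M \<in> null_sets M"
    then have "AE x in M. g x - ennreal a = 0" by (auto intro: AE_I')
    then have "excess M g a = 0" unfolding excess_def by (subst nn_integral_0_iff_AE) auto
    with inf show False by simp
  qed
  then obtain B where B[measurable]: "B \<in> sets M" and "0 < emeasure M B"
    using positive_finite_subset[of "space M"] by (auto simp: null_sets_def)
  then have "N (indicator B) \<noteq> 0" by (intro N_indicator_neq_0)
  moreover have "ennreal (real n) * N (indicator B) \<le> N g" for n
  proof -
    have "N (\<lambda>x. ennreal (real n) * indicator B x) \<le> N g"
      by (rule N_le_if_excess_le) (auto simp: all)
    then show ?thesis by (simp add: N_const_indicator)
  qed
  ultimately show False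
    using ennreal_multiples_bounded_imp_0[OF _ abs_cont_partD(2)[OF g]] by blast
qed

text \<open>In the non-atomic case sets \<open>E n\<close> shrink inside some
  \<open>{g > c}\<close>, where \<open>c\<close> times their indicators lies below \<open>g\<close>;
  once the norm is small, the measure of \<open>E n\<close> serves as \<open>\<delta>\<close>. In
  the atomic case \<open>\<delta>\<close> is the measure gap, below which only null sets
  remain.\<close>

lemma abs_cont_indicator_small:
  assumes "resonant M" and g: "g \<in> abs_cont_part M N" and nz: "\<not> (AE x in M. g x = 0)" and "0 < e"
  obtains \<delta> where "0 < \<delta>" "\<And>D. D \<in> sets M \<Longrightarrow> emeasure M D < \<delta> \<Longrightarrow> N (indicator D) < ennreal e"
proof -
  have gm[measurable]: "g \<in> borel_measurable M" by (rule abs_cont_partD(1)[OF g])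
  consider "non_atomic M" | "completely_atomic M" "\<forall>A B. atom M A \<longrightarrow> atom M B \<longrightarrow> emeasure M A = emeasure M B"
    using assms(1) unfolding resonant_def by blast
  then show thesis
  proof cases
    case 1
    obtain c where c: "0 < c" "emeasure M {x \<in> space M. ennreal c < g x} \<noteq> 0"
      using exists_positive_level[OF gm nz] by blast
    then obtain B where B: "B \<in> sets M" "B \<subseteq> {x \<in> space M. ennreal c < g x}" "0 < emeasure M B" "emeasure M B < \<infinity>"
      using positive_finite_subset[of "{x \<in> space M. ennreal c < g x}"] by auto
    obtain E :: "nat \<Rightarrow> 'a set" where E: "\<And>n. E n \<in> sets M" "\<And>n. E n \<subseteq> B" "\<And>n. 0 < emeasure M (E n)"
      "AE x in M. (\<lambda>n. indicator (E n) x :: real) \<longlonglongrightarrow> 0"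
      using non_atomic_shrinking_sequence[OF 1 B(1,3,4)] by blast
    note [measurable] = E(1)
    obtain n where n: "N (\<lambda>x. g x * indicator (E n) x) < ennreal (c * e)"
      using abs_cont_part_small[OF g E(1,4), of "c * e"] c(1) assms(4) by auto
    have "N (\<lambda>x. ennreal c * indicator (E n) x) \<le> N (\<lambda>x. g x * indicator (E n) x)"
      using E(2)[of n] B(2) by (intro N_mono) (auto simp: indicator_def)
    then have "ennreal c * N (indicator (E n)) < ennreal (c * e)"
      using n c(1) by (simp add: N_const_indicator)
    then have small: "N (indicator (E n)) < ennreal e" using c(1) by (simp add: ennreal_cmult_less_iff)
    show thesis
    proof (rule that[OF E(3)[of n]])
      fix D assume "D \<in> sets M" "emeasure M D < emeasure M (E n)"
      then show "N (indicator D) < ennreal e"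
        using N_indicator_mono_measure[of D "E n", OF _ _ less_imp_le] small by (auto intro: le_less_trans)
    qed
  next
    case 2
    then obtain c where c: "0 < c" "\<forall>D\<in>sets M. emeasure M D \<noteq> 0 \<longrightarrow> c \<le> emeasure M D"
      using equal_atoms_measure_gap[of M] by blast
    show thesis
    proof (rule that[OF c(1)])
      fix D assume [measurable]: "D \<in> sets M" and "emeasure M D < c"
      then have "D \<in> null_sets M" using c(2) by (auto simp: null_sets_def not_le[symmetric])
      then have "AE x in M. indicator D x = (0::ennreal)"
        using AE_not_in[of D M] by (auto elim!: eventually_mono)
      then have "N (indicator D) = 0" by (subst N_eq_0_iff) auto
      then show "N (indicator D) < ennreal e" using assms(4) by simp
    qed
  qed
qed

text \<open>Since the excess is superadditive, \<open>D\<close> need not be disjoint from the support of \<open>h\<close>.\<close>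

lemma N_min_le_add_indicator:
  assumes [measurable]: "f \<in> borel_measurable M" "h \<in> borel_measurable M" "D \<in> sets M" and "0 \<le> \<epsilon>"
    and le: "\<And>u. 0 \<le> u \<Longrightarrow> u \<le> \<epsilon> \<Longrightarrow> excess M (\<lambda>x. min (f x) (ennreal \<epsilon>)) u \<le> excess M h u + ennreal \<epsilon> * emeasure M D"
  shows "N (\<lambda>x. min (f x) (ennreal \<epsilon>)) \<le> N (\<lambda>x. h x + ennreal (2 * \<epsilon>) * indicator D x)"
proof (rule N_le_if_excess_le)
  fix u :: real assume u: "0 \<le> u"
  show "excess M (\<lambda>x. min (f x) (ennreal \<epsilon>)) u \<le> excess M (\<lambda>x. h x + ennreal (2 * \<epsilon>) * indicator D x) u"
  proof (cases "u \<le> \<epsilon>")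
    case True
    \<comment> \<open>Origin of the factor 2: at every level \<open>u \<le> \<epsilon>\<close> a
      height of at least \<open>\<epsilon>\<close> is left above \<open>u\<close>. At higher levels
      the truncated function has no excess.\<close>
    have "ennreal \<epsilon> * emeasure M D \<le> excess M (\<lambda>x. ennreal (2 * \<epsilon>) * indicator D x) u"
      using True u by (subst excess_const_indicator) (auto intro!: mult_right_mono ennreal_leI)
    then have "excess M (\<lambda>x. min (f x) (ennreal \<epsilon>)) u
        \<le> excess M h u + excess M (\<lambda>x. ennreal (2 * \<epsilon>) * indicator D x) u"
      using le[OF u True] by (meson add_left_mono order_trans)
    also have "\<dots> \<le> excess M (\<lambda>x. h x + ennreal (2 * \<epsilon>) * indicator D x) u"
      by (rule excess_add_le) auto
    finally show ?thesis .
  qed (simp add: excess_min_eq_0)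
qed auto

section \<open>Normalised indicators, averages and the low part of a function\<close>

lemma N_mean_indicator_antimono:
  assumes [measurable]: "D \<in> sets M" "E \<in> sets M"
    and m: "emeasure M D = ennreal m" "emeasure M E = ennreal m'" "0 < m" "m \<le> m'"
  shows "N (\<lambda>x. ennreal (1 / m') * indicator E x) \<le> N (\<lambda>x. ennreal (1 / m) * indicator D x)"
proof (rule N_le_if_excess_le)
  fix u :: real assume u: "0 \<le> u"
  \<comment> \<open>The excess of an indicator of integral one on a set of measure \<open>k\<close>
    is the positive part of \<open>1 - u * k\<close>, which decreases in \<open>k\<close>.\<close>
  have *: "ennreal (1 / k - u) * ennreal k = ennreal (1 - u * k)" if "0 < k" for k
  proof (cases "u * k \<le> 1")
    case True
    then show ?thesis using that by (simp add: ennreal_mult[symmetric] field_simps)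
  next
    case False
    then show ?thesis using that by (simp add: ennreal_neg field_simps)
  qed
  have "ennreal (1 - u * m') \<le> ennreal (1 - u * m)"
    using m u by (intro ennreal_leI) (simp add: mult_left_mono)
  then show "excess M (\<lambda>x. ennreal (1 / m') * indicator E x) u \<le> excess M (\<lambda>x. ennreal (1 / m) * indicator D x) u"
    using u m * by (simp add: excess_const_indicator)
qed auto

text \<open>The averaging operator over \<open>D\<close> decreases the excess, by Jensen's inequality.\<close>

lemma N_average_le:
  assumes [measurable]: "f \<in> borel_measurable M" "D \<in> sets M"
    and m: "emeasure M D = ennreal m" "0 < m" and q: "0 \<le> q" "ennreal q \<le> (\<integral>\<^sup>+x. f x * indicator D x \<partial>M)"
  shows "ennreal q * N (\<lambda>x. ennreal (1 / m) * indicator D x) \<le> N f"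
proof -
  have "N (\<lambda>x. ennreal (q / m) * indicator D x) \<le> N f"
  proof (rule N_le_if_excess_le)
    fix u :: real assume u: "0 \<le> u"
    \<comment> \<open>On \<open>D\<close>, \<open>f\<close> is at most its part above
      \<open>u\<close> plus \<open>u\<close>. The real number \<open>q\<close> stands in for the
      integral over \<open>D\<close>, which may be infinite.\<close>
    have "ennreal q \<le> (\<integral>\<^sup>+x. (f x - ennreal u) + ennreal u * indicator D x \<partial>M)"
      by (rule order_trans[OF q(2)], rule nn_integral_mono) (auto simp: indicator_def diff_add_self_ennreal)
    also have "\<dots> = excess M f u + ennreal (u * m)"
      using u m by (subst nn_integral_add) (auto simp: excess_def nn_integral_cmult_indicator ennreal_mult)
    finally have *: "ennreal q \<le> excess M f u + ennreal (u * m)" .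
    have "ennreal (q / m - u) * ennreal m = ennreal (q - u * m)"
    proof (cases "u * m \<le> q")
      case True
      then show ?thesis using m(2) by (simp add: ennreal_mult[symmetric] field_simps)
    next
      case False
      then show ?thesis using m(2) by (simp add: ennreal_neg field_simps)
    qed
    also have "\<dots> = ennreal q - ennreal (u * m)" using u m(2) by (simp add: ennreal_minus)
    also have "\<dots> \<le> excess M f u"
      using * by (simp add: ennreal_minus_le_iff add.commute)
    finally show "excess M (\<lambda>x. ennreal (q / m) * indicator D x) u \<le> excess M f u"
      using u m by (simp add: excess_const_indicator)
  qed auto
  moreover have "N (\<lambda>x. ennreal (q / m) * indicator D x) = ennreal q * N (\<lambda>x. ennreal (1 / m) * indicator D x)"
    using q(1) m(2) by (simp add: N_const_indicator ennreal_mult[symmetric] mult.assoc[symmetric])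
  ultimately show ?thesis by simp
qed

lemma N_two_const_indicator:
  assumes [measurable]: "D \<in> sets M" and "0 < m" "0 \<le> k"
  shows "N (\<lambda>x. ennreal (2 * (k / m)) * indicator D x) = ennreal (2 * k) * N (\<lambda>x. ennreal (1 / m) * indicator D x)"
  using assms by (simp add: N_const_indicator ennreal_mult[symmetric] mult.assoc[symmetric])

text \<open>On a space of finite measure the constant \<open>\<epsilon>\<close> is already small in
  norm. Otherwise the low part of \<open>f\<close> is compared with a low plateau on a large set
  \<open>D n\<close>, whose cost is governed by the normalised indicators of norm
  \<open>R n\<close>.\<close>

lemma min_small_if_excess_le:
  assumes g: "g \<in> abs_cont_part M N" and fm[measurable]: "f \<in> borel_measurable M" and Nf: "N f < \<infinity>"
    and ex: "\<And>u. 0 \<le> u \<Longrightarrow> excess M f u \<le> excess M g u" and "0 < e"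
  obtains \<epsilon> where "0 < \<epsilon>" "N (\<lambda>x. min (f x) (ennreal \<epsilon>)) < ennreal e"
proof (cases "emeasure M (space M) < \<infinity>")
  case True
  then obtain r where r: "N (indicator (space M)) = ennreal r" "0 \<le> r"
    using N_indicator_finite[of "space M"] by (cases "N (indicator (space M))") auto
  define \<epsilon> where "\<epsilon> = e / (r + 1)"
  have \<epsilon>: "0 < \<epsilon>" "\<epsilon> * r < e" using assms(5) r(2) by (auto simp: \<epsilon>_def field_simps)
  have "N (\<lambda>x. min (f x) (ennreal \<epsilon>)) \<le> N (\<lambda>x. ennreal \<epsilon> * indicator (space M) x)"
    by (rule N_mono) auto
  also have "\<dots> < ennreal e"
    using \<epsilon> r assms(5) by (simp add: N_const_indicator ennreal_mult[symmetric] ennreal_less_iff)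
  finally show thesis using that \<epsilon>(1) by blast
next
  case False
  have gm[measurable]: "g \<in> borel_measurable M" by (rule abs_cont_partD(1)[OF g])
  obtain A :: "nat \<Rightarrow> 'a set" where A: "range A \<subseteq> sets M" "incseq A" "(\<Union>n. A n) = space M"
    "\<And>n. emeasure M (A n) < \<infinity>"
    by (rule exhaustion) auto
  have [measurable]: "A n \<in> sets M" for n using A(1) by auto
  have SUPA: "(SUP n. emeasure M (A n)) = \<infinity>"
    using SUP_emeasure_incseq[OF A(1,2)] A(3) False by (simp add: not_less top_unique)
  have large: "\<exists>n. ennreal b < emeasure M (A n)" for b
    using SUPA by (metis ennreal_less_top infinity_ennreal_def less_SUP_iff)
  \<comment> \<open>Starting the exhaustion at \<open>n0\<close> makes all measures
    \<open>m n\<close> exceed 1, so division by them is safe.\<close>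
  obtain n0 where n0: "ennreal 1 < emeasure M (A n0)" using large by blast
  define D where "D n = A (n + n0)" for n
  have D[measurable]: "D n \<in> sets M" for n by (simp add: D_def)
  have incD: "incseq D" using A(2) by (auto simp: D_def incseq_def)
  have unionD: "(\<Union>n. D n) = space M"
  proof (rule antisym)
    show "(\<Union>n. D n) \<subseteq> space M" by (intro UN_least sets.sets_into_space D)
    have "A n \<subseteq> D n" for n using A(2) by (simp add: D_def incseq_def)
    then show "space M \<subseteq> (\<Union>n. D n)" unfolding A(3)[symmetric] by (intro UN_mono) auto
  qed
  define m where "m n = measure M (D n)" for n
  have em: "emeasure M (D n) = ennreal (m n)" for n
    using A(4)[of "n + n0"] by (simp add: m_def D_def emeasure_eq_ennreal_measure less_top)
  have mono_m: "m k \<le> m n" if "k \<le> n" for k n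
  proof -
    have "emeasure M (D k) \<le> emeasure M (D n)" using incD that by (intro emeasure_mono) (auto simp: incseq_def)
    then show ?thesis by (simp add: em m_def)
  qed
  have m_pos: "0 < m n" for n
  proof -
    have "1 < m 0" using n0 em[of 0] by (simp add: D_def ennreal_less_iff flip: ennreal_1)
    then show ?thesis using mono_m[of 0 n] by simp
  qed
  have m_large: "\<exists>n. b < m n" for b
  proof -
    obtain n where "ennreal (max b 0) < emeasure M (A n)" using large by blast
    also have "\<dots> \<le> emeasure M (D n)" using A(2) by (intro emeasure_mono) (auto simp: D_def incseq_def)
    finally have "max b 0 < m n" by (simp add: em ennreal_less_iff)
    then show ?thesis by auto
  qed
  define R where "R n = N (\<lambda>x. ennreal (1 / m n) * indicator (D n) x)" for n
  have R_fin: "R n < \<infinity>" for n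
    using N_indicator_finite[OF D, of n] em[of n] m_pos[of n]
    by (simp add: R_def N_const_indicator ennreal_mult_less_top)
  have R_dec: "R n \<le> R 0" for n
    unfolding R_def using N_mean_indicator_antimono[OF D D em em m_pos mono_m] by simp
  show thesis
  \<comment> \<open>Either normalised indicators get arbitrarily small in norm, or their norms are
    bounded below by some \<open>c > 0\<close>.\<close>
  proof (cases "\<forall>c>0. \<exists>n. R n < ennreal c")
    case True
    obtain d where d: "0 < d" "\<And>p q. p \<in> borel_measurable M \<Longrightarrow> q \<in> borel_measurable M \<Longrightarrow>
        N p < ennreal d \<Longrightarrow> N q < ennreal d \<Longrightarrow> N (\<lambda>x. p x + q x) < ennreal e"
      using N_add_small[OF assms(5)] by blast
    obtain a where a: "0 < a" "N (\<lambda>x. min (g x) (ennreal a)) < ennreal d"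
      using abs_cont_min_small[OF g d(1)] by blast
    obtain k where k: "excess M g a = ennreal k" "0 \<le> k"
      using abs_cont_excess_finite[OF g a(1)] by (cases "excess M g a") auto
    obtain n where n: "R n < ennreal (d / (2 * (k + 1)))"
      using True d(1) k(2) by (metis add_nonneg_pos divide_pos_pos mult_pos_pos zero_less_numeral zero_less_one)
    \<comment> \<open>Now \<open>\<epsilon>\<close> times the measure of \<open>D n\<close> is
      \<open>k + 1\<close>, enough to cover the excess \<open>k\<close>, while the plateau of height
      \<open>2 * \<epsilon>\<close> has norm \<open>2 * (k + 1) * R n < d\<close>. The added 1 keeps
      \<open>\<epsilon>\<close> positive when \<open>k = 0\<close>.\<close>
    define \<epsilon> where "\<epsilon> = (k + 1) / m n"
    have \<epsilon>: "0 < \<epsilon>" using k(2) m_pos by (simp add: \<epsilon>_def)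
    have "ennreal (2 * (k + 1)) * R n < ennreal (2 * (k + 1) * (d / (2 * (k + 1))))"
      using n k(2) by (subst ennreal_cmult_less_iff) auto
    then have "N (\<lambda>x. ennreal (2 * \<epsilon>) * indicator (D n) x) < ennreal d"
      using k(2) m_pos[of n] unfolding \<epsilon>_def R_def by (subst N_two_const_indicator) auto
    then have *: "N (\<lambda>x. min (g x) (ennreal a) + ennreal (2 * \<epsilon>) * indicator (D n) x) < ennreal e"
      using a(2) by (intro d(2)) auto
    have "N (\<lambda>x. min (f x) (ennreal \<epsilon>)) \<le> N (\<lambda>x. min (g x) (ennreal a) + ennreal (2 * \<epsilon>) * indicator (D n) x)"
    proof (rule N_min_le_add_indicator)
      fix u :: real assume u: "0 \<le> u" "u \<le> \<epsilon>"
      \<comment> \<open>The excess of \<open>g\<close> is split at height \<open>a\<close>: the part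
        above contributes at most \<open>k\<close>, which the plateau absorbs.\<close>
      have "excess M (\<lambda>x. min (f x) (ennreal \<epsilon>)) u \<le> excess M f u" by (rule excess_mono) simp
      also have "\<dots> \<le> excess M g u" by (rule ex[OF u(1)])
      also have "\<dots> \<le> (\<integral>\<^sup>+x. (min (g x) (ennreal a) - ennreal u) + (g x - ennreal a) \<partial>M)"
        unfolding excess_def
      proof (rule nn_integral_mono)
        fix x
        show "g x - ennreal u \<le> (min (g x) (ennreal a) - ennreal u) + (g x - ennreal a)"
          using a(1) u(1)
          by (cases "g x") (auto simp: ennreal_minus_if min_def simp flip: ennreal_plus)
      qed
      also have "\<dots> = excess M (\<lambda>x. min (g x) (ennreal a)) u + ennreal k"
        unfolding k(1)[symmetric] excess_def by (subst nn_integral_add) auto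
      also have "ennreal k \<le> ennreal \<epsilon> * emeasure M (D n)"
        using \<epsilon> m_pos[of n] k(2) by (simp add: em ennreal_mult[symmetric] \<epsilon>_def)
      finally show "excess M (\<lambda>x. min (f x) (ennreal \<epsilon>)) u
          \<le> excess M (\<lambda>x. min (g x) (ennreal a)) u + ennreal \<epsilon> * emeasure M (D n)"
        by (simp add: add_left_mono)
    qed (use \<epsilon> in auto)
    then show thesis using * \<epsilon> that by (meson le_less_trans)
  next
    case False
    \<comment> \<open>Averaging bounds the integral of \<open>f\<close> over each \<open>D n\<close>
      by \<open>b / c\<close>; monotone convergence makes \<open>f\<close> integrable.\<close>
    then obtain c where c: "0 < c" "\<And>n. ennreal c \<le> R n" by (auto simp: not_less)
    obtain b where b: "N f = ennreal b" "0 \<le> b" using Nf by (cases "N f") auto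
    have "(\<integral>\<^sup>+x. f x * indicator (D n) x \<partial>M) \<le> ennreal (b / c)" for n
    proof (rule ccontr)
      assume "\<not> ?thesis"
      then obtain z where z: "ennreal (b / c) < z" "z < (\<integral>\<^sup>+x. f x * indicator (D n) x \<partial>M)"
        using dense by (auto simp: not_le)
      then obtain q where q: "z = ennreal q" "0 \<le> q" by (cases z) auto
      have "ennreal (q * c) \<le> ennreal q * R n"
        using c q(2) by (simp add: ennreal_mult mult_left_mono)
      also have "\<dots> \<le> ennreal b"
        using N_average_le[OF fm D em m_pos q(2)] z(2) q(1) b by (simp add: R_def)
      finally have "q * c \<le> b" using b(2) by simp
      moreover have "b / c < q" using z(1) q b(2) c(1) by (simp add: ennreal_less_iff)
      ultimately show False using c(1) by (simp add: field_simps)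
    qed
    then have "(SUP n. \<integral>\<^sup>+x. f x * indicator (D n) x \<partial>M) \<le> ennreal (b / c)" by (rule SUP_least)
    moreover have "(SUP n. \<integral>\<^sup>+x. f x * indicator (D n) x \<partial>M) = (\<integral>\<^sup>+x. (SUP n. f x * indicator (D n) x) \<partial>M)"
      using incD by (intro nn_integral_monotone_convergence_SUP[symmetric])
        (auto simp: incseq_def le_fun_def indicator_def)
    moreover have "(\<integral>\<^sup>+x. (SUP n. f x * indicator (D n) x) \<partial>M) = (\<integral>\<^sup>+x. f x \<partial>M)"
    proof (rule nn_integral_cong)
      fix x assume "x \<in> space M"
      then obtain n where "x \<in> D n" using unionD by blast
      then have "f x * indicator (D n) x = f x" by simp
      then have "f x \<le> (SUP n. f x * indicator (D n) x)" by (metis SUP_upper UNIV_I)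
      moreover have "(SUP n. f x * indicator (D n) x) \<le> f x"
        by (rule SUP_least) (auto simp: indicator_def)
      ultimately show "(SUP n. f x * indicator (D n) x) = f x" by (rule antisym[rotated])
    qed
    ultimately have int: "(\<integral>\<^sup>+x. f x \<partial>M) < \<infinity>" by (auto intro: le_less_trans)
    obtain r where r: "R 0 = ennreal r" "0 \<le> r" using R_fin[of 0] by (cases "R 0") auto
    \<comment> \<open>Chosen for the final bound \<open>2 * \<delta> * R 0 < e\<close>, which is
      uniform in \<open>n\<close> because \<open>R n \<le> R 0\<close>.\<close>
    define \<delta> where "\<delta> = e / (2 * (r + 1))"
    have \<delta>: "0 < \<delta>" "2 * \<delta> * r < e" using assms(5) r(2) by (auto simp: \<delta>_def field_simps)
    have "(\<lambda>j. \<integral>\<^sup>+x. min (f x) (ennreal (1 / real (Suc j))) \<partial>M) \<longlonglongrightarrow> (\<integral>\<^sup>+x. 0 \<partial>M)"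
    proof (rule nn_integral_dominated_convergence[where w = f])
      show "AE x in M. (\<lambda>j. min (f x) (ennreal (1 / real (Suc j)))) \<longlonglongrightarrow> 0"
      proof (rule AE_I2)
        fix x
        have "(\<lambda>j. ennreal (1 / real (Suc j))) \<longlonglongrightarrow> ennreal 0"
          by (intro tendsto_ennrealI LIMSEQ_Suc[OF lim_1_over_n])
        then have "(\<lambda>j. min (f x) (ennreal (1 / real (Suc j)))) \<longlonglongrightarrow> min (f x) (ennreal 0)"
          by (intro tendsto_min tendsto_const)
        then show "(\<lambda>j. min (f x) (ennreal (1 / real (Suc j)))) \<longlonglongrightarrow> 0"
          by (simp add: min_absorb2 del: of_nat_Suc)
      qed
    qed (use int in auto)
    then have "eventually (\<lambda>j. (\<integral>\<^sup>+x. min (f x) (ennreal (1 / real (Suc j))) \<partial>M) < ennreal \<delta>) sequentially"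
      using \<delta>(1) by (intro order_tendstoD(2)) auto
    then obtain j where j: "(\<integral>\<^sup>+x. min (f x) (ennreal (1 / real (Suc j))) \<partial>M) < ennreal \<delta>"
      by (auto simp: eventually_sequentially)
    \<comment> \<open>The index \<open>j\<close> is fixed first, by dominated convergence. A large
      \<open>D n\<close> then brings \<open>\<epsilon> = \<delta> / m n\<close> below
      \<open>1 / Suc j\<close>, so \<open>\<delta>\<close> bounds the integral of the truncation at
      \<open>\<epsilon>\<close> as well.\<close>
    obtain n where n: "\<delta> * real (Suc j) < m n" using m_large by blast
    define \<epsilon> where "\<epsilon> = \<delta> / m n"
    have \<epsilon>: "0 < \<epsilon>" "\<epsilon> \<le> 1 / real (Suc j)"
      using \<delta>(1) n m_pos[of n] by (auto simp: \<epsilon>_def field_simps)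
    have "N (\<lambda>x. min (f x) (ennreal \<epsilon>)) \<le> N (\<lambda>x. 0 + ennreal (2 * \<epsilon>) * indicator (D n) x)"
    proof (rule N_min_le_add_indicator)
      fix u :: real
      have "excess M (\<lambda>x. min (f x) (ennreal \<epsilon>)) u \<le> (\<integral>\<^sup>+x. min (f x) (ennreal \<epsilon>) \<partial>M)"
        by (rule excess_le_nn_integral)
      also have "\<dots> \<le> (\<integral>\<^sup>+x. min (f x) (ennreal (1 / real (Suc j))) \<partial>M)"
        using \<epsilon>(2) by (intro nn_integral_mono min.mono ennreal_leI) auto
      also have "\<dots> \<le> ennreal \<delta>" using j by simp
      also have "\<dots> = ennreal \<epsilon> * emeasure M (D n)"
        using \<epsilon> m_pos[of n] by (simp add: em ennreal_mult[symmetric] \<epsilon>_def)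
      finally show "excess M (\<lambda>x. min (f x) (ennreal \<epsilon>)) u \<le> excess M (\<lambda>x. 0) u + ennreal \<epsilon> * emeasure M (D n)"
        by (simp add: excess_def)
    qed (use \<epsilon> in auto)
    also have "\<dots> = ennreal (2 * \<delta>) * R n"
      using m_pos[of n] \<delta>(1) by (simp add: \<epsilon>_def R_def N_two_const_indicator[symmetric] del: times_divide_eq_right)
    also have "\<dots> \<le> ennreal (2 * \<delta>) * R 0" by (intro mult_left_mono R_dec) simp
    also have "\<dots> < ennreal e"
      using r \<delta> assms(5) by (simp add: ennreal_mult[symmetric] ennreal_less_iff)
    finally show thesis using that \<epsilon>(1) by blast
  qed
qed

section \<open>Transfer of absolute continuity along the relation\<close>

lemma abs_cont_part_if_hlp_prec:
  assumes "resonant M" and g: "g \<in> abs_cont_part M N" and f: "f \<in> fspace M N" and "hlp_prec M f g"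
  shows "f \<in> abs_cont_part M N"
proof -
  have gm[measurable]: "g \<in> borel_measurable M" by (rule abs_cont_partD(1)[OF g])
  have fm[measurable]: "f \<in> borel_measurable M" and Nf: "N f < \<infinity>" using f by (auto simp: fspace_def)
  have ex: "excess M f u \<le> excess M g u" if "0 \<le> u" for u
    using assms(4) that hlp_prec_iff_excess[OF sigma_finite_measure_axioms fm gm] by blast
  have "(\<lambda>k. N (\<lambda>x. f x * indicator (E k) x)) \<longlonglongrightarrow> 0"
    if E[measurable]: "\<And>k. E k \<in> sets M" and lim: "AE x in M. (\<lambda>k. indicator (E k) x :: real) \<longlonglongrightarrow> 0"
    for E :: "nat \<Rightarrow> 'a set"
  proof (cases "AE x in M. g x = 0")
    \<comment> \<open>Small indicators are only controlled by a nonzero \<open>g\<close>; here the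
      excess at level 0, the full integral, forces \<open>f\<close> to vanish as well.\<close>
    case True
    have "excess M g 0 = 0" unfolding excess_def using True by (subst nn_integral_0_iff_AE) auto
    then have "excess M f 0 = 0" using ex[of 0] by simp
    then have "AE x in M. f x = 0" unfolding excess_def by (subst (asm) nn_integral_0_iff_AE) auto
    then have "AE x in M. f x * indicator (E k) x = 0" for k by eventually_elim simp
    then have "N (\<lambda>x. f x * indicator (E k) x) = 0" for k by (subst N_eq_0_iff) auto
    then show ?thesis by simp
  next
    case False
    show ?thesis unfolding ennreal_tendsto_0_iff
    proof (intro allI impI)
      fix e :: real assume "0 < e"
      \<comment> \<open>The sum has three terms, so smallness is passed down twice.\<close>
      obtain d1 where d1: "0 < d1" "\<And>p q. p \<in> borel_measurable M \<Longrightarrow> q \<in> borel_measurable M \<Longrightarrow>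
          N p < ennreal d1 \<Longrightarrow> N q < ennreal d1 \<Longrightarrow> N (\<lambda>x. p x + q x) < ennreal e"
        using N_add_small[OF \<open>0 < e\<close>] by blast
      obtain d2 where d2: "0 < d2" "\<And>p q. p \<in> borel_measurable M \<Longrightarrow> q \<in> borel_measurable M \<Longrightarrow>
          N p < ennreal d2 \<Longrightarrow> N q < ennreal d2 \<Longrightarrow> N (\<lambda>x. p x + q x) < ennreal d1"
        using N_add_small[OF d1(1)] by blast
      obtain s where s: "0 \<le> s" "N (\<lambda>x. g x - ennreal s) < ennreal d1"
        using abs_cont_peak_small[OF g d1(1)] by blast
      have "N (\<lambda>x. f x - ennreal s) \<le> N (\<lambda>x. g x - ennreal s)"
        using s(1) by (intro N_le_if_excess_le) (auto simp: excess_diff ex)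
      then have peak: "N (\<lambda>x. f x - ennreal s) < ennreal d1" using s(2) by simp
      obtain \<epsilon> where \<epsilon>: "0 < \<epsilon>" "N (\<lambda>x. min (f x) (ennreal \<epsilon>)) < ennreal d2"
        using min_small_if_excess_le[OF g fm Nf ex d2(1)] by blast
      obtain \<delta> where \<delta>: "0 < \<delta>" "\<And>D. D \<in> sets M \<Longrightarrow> emeasure M D < \<delta> \<Longrightarrow> N (indicator D) < ennreal (d2 / (s + 1))"
        using abs_cont_indicator_small[OF assms(1) g False, of "d2 / (s + 1)"] d2(1) s(1) by auto
      define S where "S = {x \<in> space M. ennreal \<epsilon> < f x}"
      have [measurable]: "S \<in> sets M" by (simp add: S_def)
      \<comment> \<open>Markov's inequality at half the level: on \<open>S\<close>, \<open>f\<close>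
        exceeds \<open>\<epsilon> / 2\<close> by at least \<open>\<epsilon> / 2\<close>.\<close>
      have "ennreal (\<epsilon> / 2) * emeasure M S = (\<integral>\<^sup>+x. ennreal (\<epsilon> / 2) * indicator S x \<partial>M)"
        by (simp add: nn_integral_cmult_indicator)
      also have "\<dots> \<le> excess M f (\<epsilon> / 2)"
        unfolding excess_def
      proof (rule nn_integral_mono)
        fix x
        show "ennreal (\<epsilon> / 2) * indicator S x \<le> f x - ennreal (\<epsilon> / 2)"
          using \<epsilon>(1) by (cases "f x") (auto simp: S_def indicator_def ennreal_minus_if ennreal_less_iff)
      qed
      also have "\<dots> \<le> excess M g (\<epsilon> / 2)" using \<epsilon>(1) by (intro ex) simp
      also have "\<dots> < \<infinity>" using \<epsilon>(1) by (intro abs_cont_excess_finite[OF g]) simp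
      finally have S: "emeasure M S < \<infinity>" using \<epsilon>(1) by (auto simp: ennreal_mult_less_top)
      \<comment> \<open>The sets \<open>E k\<close> need not be nested; the indicator of
        \<open>S\<close>, integrable by the previous bound, is the dominating function.\<close>
      have "(\<lambda>k. \<integral>\<^sup>+x. indicator (S \<inter> E k) x \<partial>M) \<longlonglongrightarrow> (\<integral>\<^sup>+x. 0 \<partial>M)"
      proof (rule nn_integral_dominated_convergence[where w = "indicator S"])
        show "AE x in M. (\<lambda>k. indicator (S \<inter> E k) x :: ennreal) \<longlonglongrightarrow> 0"
          using lim
        proof eventually_elim
          case (elim x)
          then have "(\<lambda>k. ennreal (indicator S x * indicator (E k) x)) \<longlonglongrightarrow> ennreal (indicator S x * 0)"
            by (intro tendsto_ennrealI tendsto_mult tendsto_const)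
          then show ?case by (simp add: indicator_inter_arith[symmetric] ennreal_indicator)
        qed
      qed (use S in \<open>auto split: split_indicator\<close>)
      then have "eventually (\<lambda>k. emeasure M (S \<inter> E k) < \<delta>) sequentially"
        using \<delta>(1) by (intro order_tendstoD(2)) auto
      then show "eventually (\<lambda>k. N (\<lambda>x. f x * indicator (E k) x) < ennreal e) sequentially"
      proof eventually_elim
        case (elim k)
        have "ennreal s * N (indicator (S \<inter> E k)) \<le> ennreal (s + 1) * N (indicator (S \<inter> E k))"
          by (intro mult_right_mono ennreal_leI) auto
        also have "\<dots> < ennreal ((s + 1) * (d2 / (s + 1)))"
          using \<delta>(2)[OF _ elim] s(1) by (subst ennreal_cmult_less_iff) auto
        finally have "N (\<lambda>x. ennreal s * indicator (S \<inter> E k) x) < ennreal d2"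
          using s(1) by (simp add: N_const_indicator)
        then have "N (\<lambda>x. ennreal s * indicator (S \<inter> E k) x + min (f x) (ennreal \<epsilon>)) < ennreal d1"
          using \<epsilon>(2) by (intro d2(2)) auto
        then have "N (\<lambda>x. (f x - ennreal s) + (ennreal s * indicator (S \<inter> E k) x + min (f x) (ennreal \<epsilon>))) < ennreal e"
          using peak by (intro d1(2)) auto
        \<comment> \<open>On \<open>S \<inter> E k\<close> the first two terms cover
          \<open>f\<close>; elsewhere in \<open>E k\<close>, \<open>f\<close> is at most
          \<open>\<epsilon>\<close> and the last term covers it.\<close>
        moreover have "N (\<lambda>x. f x * indicator (E k) x)
            \<le> N (\<lambda>x. (f x - ennreal s) + (ennreal s * indicator (S \<inter> E k) x + min (f x) (ennreal \<epsilon>)))"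
        proof (rule N_mono)
          fix x assume x: "x \<in> space M"
          show "f x * indicator (E k) x
              \<le> (f x - ennreal s) + (ennreal s * indicator (S \<inter> E k) x + min (f x) (ennreal \<epsilon>))"
          proof (cases "x \<in> E k \<and> x \<in> S")
            case True
            then have "f x * indicator (E k) x \<le> (f x - ennreal s) + ennreal s * indicator (S \<inter> E k) x"
              by (auto simp: diff_add_self_ennreal)
            then show ?thesis by (simp add: add.assoc[symmetric] add_increasing2)
          next
            case False
            then have "f x * indicator (E k) x \<le> min (f x) (ennreal \<epsilon>)"
              using x by (auto simp: S_def indicator_def)
            then show ?thesis by (simp add: add_increasing)
          qed
        qed auto
        ultimately show ?case by simp
      qed
    qed
  qed
  then show ?thesis using f by (simp add: abs_cont_part_def)
qed

end

theorem mainTheorem11: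
  fixes M :: "'a measure" and N :: "('a \<Rightarrow> ennreal) \<Rightarrow> ennreal"
    and f g :: "'a \<Rightarrow> ennreal"
  assumes "sigma_finite_measure M"
    and "resonant M"
    and "quasi_banach_function_norm M N"
    and "rearrangement_invariant M N"
    and "HLP_principle M N"
    and "f \<in> fspace M N" and "g \<in> fspace M N"
    and "hlp_prec M f g"
    and "g \<in> abs_cont_part M N"
  shows "f \<in> abs_cont_part M N"
proof -
  interpret hlp_function_norm M N
    using assms by (intro hlp_function_norm.intro hlp_function_norm_axioms.intro)
  show ?thesis by (rule abs_cont_part_if_hlp_prec) fact+
qed

end
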